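(* Let $p\ge 5$ be a prime number and let $R$ be a commutative ring. (a) If $\mathbb Z_p\subset R$, then $GI^c_1(R)=[GA^c_1(R),GA^c_1(R)]^{(2)}$. (b) If $\mathbb Z_p\subset R$ and $n\ge 2$, then $GI^c_n(R)\subset[GA^c_n(R),GA^c_n(R)]^{(n(n+3))}$. (c) If $R$ is a field of characteristic $p$ (and $n$ is a natural number), then $GI^c_n(R)\subset[GA^c_n(R),GA^c_n(R)]^{(4n)}$.
   Context: $\mathbb Z_p$ denotes the field with $p$ elements. $GA^c_n(R)$ is the group (under composition) of augmented continuous $R$-algebra automorphisms of $R[[X_1,\ldots,X_n]]$, where augmented and continuous are understood with respect to the ideal $\mathfrak M=(X_1,\ldots,X_n)R[[X_1,\ldots,X_n]]$ and the corresponding additive ($\mathfrak M$-adic) topology. Such an automorphism is determined by its values $X_i\mapsto h_i^{(1)}+h_i^{(2)}+\cdots$, with $h_i^{(j)}\in R[X_1,\ldots,X_n]$ homogeneous of degree $j$. $GI^c_n(R)$ is the kernel of the natural surjection $GA^c_n(R)\to\operatorname{Aut}(R[[X_1,\ldots,X_n]]/\mathfrak M^2)=GL_n(R)$, i.e. the group of those automorphisms with identity linear part. For a group $\Gamma$ and a natural number $k$, $[\Gamma,\Gamma]^{(k)}=\{[\beta_1,\gamma_1]\cdots[\beta_k,\gamma_k] : \beta_i,\gamma_i\in\Gamma\}$, where $[-,-]$ is the group commutator. *)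

theory Defs
  imports
    "HOL-Analysis.Analysis"
    "HOL-Number_Theory.Residues"
    "HOL-Algebra.Algebraic_Closure_Type"
    "HOL-Algebra.Generated_Groups"
    "HOL-Algebra.Ideal_Product"
    "HOL-Library.Multiset"
begin

section \<open>The ring of formal power series in the variables X_i, i :: 'n\<close>

text \<open>
  A monomial is the multiset of its variables, so that the product of monomials is the sum of
  multisets and the degree is the size. The number of variables is CARD('n).
\<close>

typedef ('a, 'n) mps = "UNIV :: ('n multiset \<Rightarrow> 'a) set"
  morphisms mps_coeff Abs_mps
  by simp

setup_lifting type_definition_mps

lemma mps_eqI: "(\<And>m. mps_coeff f m = mps_coeff g m) \<Longrightarrow> f = g"
  by (metis mps_coeff_inject ext)

lemma finite_submultisets: "finite {k. k \<subseteq># m}"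
proof (rule finite_subset)
  show "{k. k \<subseteq># m} \<subseteq> mset ` {xs. set xs \<subseteq> set_mset m \<and> length xs \<le> size m}"
  proof
    fix k assume "k \<in> {k. k \<subseteq># m}"
    moreover obtain xs where "k = mset xs" by (metis ex_mset)
    ultimately show "k \<in> mset ` {xs. set xs \<subseteq> set_mset m \<and> length xs \<le> size m}"
      using set_mset_mono size_mset_mono by fastforce
  qed
  show "finite (mset ` {xs. set xs \<subseteq> set_mset m \<and> length xs \<le> size m})"
    by (intro finite_imageI finite_lists_length_le) simp
qed

instantiation mps :: (comm_ring_1, type) comm_ring_1
begin

lift_definition zero_mps :: "('a, 'b) mps" is "\<lambda>_. 0" .
lift_definition one_mps :: "('a, 'b) mps" is "\<lambda>m. if m = {#} then 1 else 0" .
lift_definition plus_mps :: "('a, 'b) mps \<Rightarrow> ('a, 'b) mps \<Rightarrow> ('a, 'b) mps"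
  is "\<lambda>f g m. f m + g m" .
lift_definition minus_mps :: "('a, 'b) mps \<Rightarrow> ('a, 'b) mps \<Rightarrow> ('a, 'b) mps"
  is "\<lambda>f g m. f m - g m" .
lift_definition uminus_mps :: "('a, 'b) mps \<Rightarrow> ('a, 'b) mps"
  is "\<lambda>f m. - f m" .
lift_definition times_mps :: "('a, 'b) mps \<Rightarrow> ('a, 'b) mps \<Rightarrow> ('a, 'b) mps"
  is "\<lambda>f g m. \<Sum>k | k \<subseteq># m. f k * g (m - k)" .

instance
proof
  fix f g h :: "('a, 'b) mps"
  show "f * g * h = f * (g * h)"
  proof (rule mps_eqI)
    fix m :: "'b multiset"
    have "mps_coeff (f * g * h) m =
        (\<Sum>(k, l)\<in>(SIGMA k:{k. k \<subseteq># m}. {l. l \<subseteq># k}).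
          mps_coeff f l * mps_coeff g (k - l) * mps_coeff h (m - k))"
      by (simp add: times_mps.rep_eq sum_distrib_right sum.Sigma finite_submultisets)
    also have "\<dots> = (\<Sum>(l, j)\<in>(SIGMA l:{l. l \<subseteq># m}. {j. j \<subseteq># m - l}).
          mps_coeff f l * mps_coeff g j * mps_coeff h (m - l - j))"
    proof (rule sum.reindex_bij_witness[where i = "\<lambda>(l, j). (l + j, l)" and j = "\<lambda>(k, l). (l, k - l)"],
        goal_cases)
      case (1 x) then show ?case by auto
    next
      case (2 x) then show ?case
        by (auto simp: subset_eq_diff_conv add.commute intro: subset_mset.order_trans)
    next
      case (3 x) then show ?case by auto
    next
      case (4 x)
      then show ?case
        by (auto simp: subset_mset.add_diff_inverse)
          (metis subset_mset.add_diff_inverse mset_subset_eq_mono_add_left_cancel)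
    next
      case (5 x)
      then show ?case by (auto simp: diff_diff_add_mset subset_mset.add_diff_inverse)
    qed
    also have "\<dots> = mps_coeff (f * (g * h)) m"
      by (simp add: times_mps.rep_eq sum_distrib_left sum.Sigma finite_submultisets mult.assoc)
    finally show "mps_coeff (f * g * h) m = mps_coeff (f * (g * h)) m" .
  qed
  show "f * g = g * f"
  proof (rule mps_eqI)
    fix m :: "'b multiset"
    show "mps_coeff (f * g) m = mps_coeff (g * f) m"
      unfolding times_mps.rep_eq
      by (rule sum.reindex_bij_witness[where i = "\<lambda>k. m - k" and j = "\<lambda>k. m - k"])
        (auto simp: mset_subset_eq_exists_conv mult.commute)
  qed
  show "1 * f = f"
  proof (rule mps_eqI)
    fix m :: "'b multiset"
    have "mps_coeff (1 * f) m = (\<Sum>k | k \<subseteq># m. if k = {#} then mps_coeff f m else 0)"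
      unfolding times_mps.rep_eq one_mps.rep_eq by (intro sum.cong) auto
    then show "mps_coeff (1 * f) m = mps_coeff f m"
      by (simp add: finite_submultisets)
  qed
  show "(f + g) * h = f * h + g * h"
    by (rule mps_eqI) (simp add: times_mps.rep_eq plus_mps.rep_eq distrib_right sum.distrib)
  show "(0 :: ('a, 'b) mps) \<noteq> 1"
    by (metis one_mps.rep_eq zero_mps.rep_eq zero_neq_one)
qed (transfer; simp add: fun_eq_iff algebra_simps)+

end

lift_definition mps_const :: "'a::comm_ring_1 \<Rightarrow> ('a, 'n) mps"
  is "\<lambda>c m. if m = {#} then c else 0" .

lift_definition mps_X :: "'n \<Rightarrow> ('a::comm_ring_1, 'n) mps"
  is "\<lambda>i m. if m = {#i#} then 1 else 0" .


section \<open>The augmentation ideal and its adic topology\<close>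

definition mps_ideal :: "('a::comm_ring_1, 'n::finite) mps set" where
  "mps_ideal = genideal ring_of_type_algebra (range mps_X)"

primrec mps_ideal_power :: "nat \<Rightarrow> ('a::comm_ring_1, 'n::finite) mps set" where
  "mps_ideal_power 0 = UNIV"
| "mps_ideal_power (Suc k) = ideal_prod ring_of_type_algebra mps_ideal (mps_ideal_power k)"

definition mps_adic_topology :: "('a::comm_ring_1, 'n::finite) mps topology" where
  "mps_adic_topology = topology_generated_by {(+) f ` mps_ideal_power k | f k. True}"


section \<open>Augmented continuous automorphisms\<close>

definition mps_algebra_aut :: "(('a::comm_ring_1, 'n) mps \<Rightarrow> ('a, 'n) mps) \<Rightarrow> bool" where
  "mps_algebra_aut \<phi> \<longleftrightarrow> \<phi> \<in> ring_hom ring_of_type_algebra ring_of_type_algebra \<and>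
     (\<forall>c. \<phi> (mps_const c) = mps_const c) \<and> bij \<phi>"

text \<open>
  The inverse of such an automorphism is again augmented and continuous, because an augmented
  algebra endomorphism preserves constant terms and maps every power of the ideal into itself.
\<close>

definition GA :: "'a::comm_ring_1 itself \<Rightarrow> 'n::finite itself \<Rightarrow>
    (('a, 'n) mps \<Rightarrow> ('a, 'n) mps) monoid" where
  "GA _ _ = \<lparr>carrier = {\<phi>. mps_algebra_aut \<phi> \<and> \<phi> ` mps_ideal \<subseteq> mps_ideal \<and>
                 continuous_map mps_adic_topology mps_adic_topology \<phi>},
             mult = (\<circ>), one = id\<rparr>"

text \<open>The automorphisms that induce the identity modulo the square of the augmentation ideal:\<close>

definition GI :: "'a::comm_ring_1 itself \<Rightarrow> 'n::finite itself \<Rightarrow>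
    (('a, 'n) mps \<Rightarrow> ('a, 'n) mps) set" where
  "GI R N = {\<phi> \<in> carrier (GA R N). \<forall>f. \<phi> f - f \<in> mps_ideal_power 2}"


section \<open>Products of k commutators\<close>

text \<open>\<open>derived_set G (carrier G)\<close> is the set of all commutators, not the subgroup they generate.\<close>

primrec commutator_products :: "('g, 'm) monoid_scheme \<Rightarrow> nat \<Rightarrow> 'g set" where
  "commutator_products G 0 = {\<one>\<^bsub>G\<^esub>}"
| "commutator_products G (Suc k) = commutator_products G k <#>\<^bsub>G\<^esub> derived_set G (carrier G)"


section \<open>Rings containing the field with p elements\<close>

definition contains_Zp :: "nat \<Rightarrow> 'a::comm_ring_1 itself \<Rightarrow> bool" where
  "contains_Zp p _ \<longleftrightarrow>
     (\<exists>h \<in> ring_hom (residue_ring (int p)) (ring_of_type_algebra :: 'a ring).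
        inj_on h (carrier (residue_ring (int p))))"

end

theory Submission
  imports Defs "HOL-Number_Theory.Residue_Primitive_Roots"
begin

text \<open>
  Everything follows from one statement: if \<open>p \<ge> 5\<close> is prime and \<open>p = 0\<close> in the ring, then every
  automorphism with identity linear part in \<open>n\<close> variables is a product of \<open>2 n\<close> commutators.
  For \<open>n = 1\<close> this is the nontrivial inclusion of the first claim (the other one holds because
  one-variable automorphisms commute modulo the square of the augmentation ideal), and for every
  \<open>n\<close> the number \<open>2 n\<close> is at most \<open>n (n + 3)\<close> and \<open>4 n\<close>.

  The proof fixes \<open>2 n\<close> automorphisms \<open>a\<^sub>0, a\<^sub>1, \<dots>\<close> and solves
  \<open>h = [a\<^sub>0, g\<^sub>0] [a\<^sub>1, g\<^sub>1] \<cdots>\<close> for the \<open>g\<^sub>t\<close> one degree at a time. Say that an automorphism has depth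
  \<open>d\<close> if it moves each variable by terms of degree greater than \<open>d\<close>. Conjugation by an
  automorphism of depth 1 does not change what an automorphism of depth \<open>d\<close> does in degree
  \<open>d + 1\<close>. Since \<open>[a, g x] = [a, g] (g [a, x] g\<^sup>-\<^sup>1)\<close>, replacing \<open>g\<^sub>t\<close> by \<open>g\<^sub>t x\<close>
  therefore simply adds the leading term of \<open>[a\<^sub>t, x]\<close> to the product
  (\<open>comm_prod_update\<close>). So it suffices that every homogeneous vector field
  \<open>r X\<^sup>\<alpha> \<partial>\<^sub>j\<close> of degree \<open>|\<alpha>| = d + 1 \<ge> 2\<close> is the leading term of some \<open>[a\<^sub>t, x]\<close>
  with \<open>x\<close> of depth going to infinity with \<open>d\<close> (\<open>every_term_hit\<close>); the successive \<open>g\<^sub>t\<close> then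
  converge (\<open>comm_prod_surj\<close>).

  The \<open>a\<^sub>t\<close> are, for each variable \<open>X\<^sub>i\<close>, the substitutions
  \<open>\<sigma>\<^sub>i : X\<^sub>i \<mapsto> X\<^sub>i + X\<^sub>i\<^sup>2\<close> and \<open>\<tau>\<^sub>i = D\<^sub>i \<circ> (X\<^sub>i \<mapsto> X\<^sub>i + X\<^sub>i\<^sup>p)\<close>, where \<open>D\<^sub>i\<close> multiplies \<open>X\<^sub>i\<close>
  by a primitive root \<open>u\<close> modulo \<open>p\<close>. Writing \<open>\<delta> = 1\<close> if \<open>i = j\<close> and \<open>\<delta> = 0\<close> otherwise,
  conjugation by \<open>D\<^sub>i\<close> multiplies \<open>X\<^sup>\<alpha> \<partial>\<^sub>j\<close> by \<open>u\<close> to the power \<open>\<alpha>\<^sub>i - \<delta>\<close>. Thus \<open>\<tau>\<^sub>i\<close> reaches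
  \<open>X\<^sup>\<alpha> \<partial>\<^sub>j\<close> unless \<open>\<alpha>\<^sub>i \<equiv> \<delta>\<close> modulo \<open>p - 1\<close>. There remain the resonant terms, for which this
  congruence holds for all \<open>i\<close>. For such a term choose \<open>i\<close> with \<open>\<alpha>\<^sub>i = \<delta> + k (p - 1)\<close>,
  \<open>k \<ge> 1\<close>. Bracketing with \<open>X\<^sub>i\<^sup>2 \<partial>\<^sub>i\<close> produces it from \<open>X\<^sup>\<alpha> / X\<^sub>i \<partial>\<^sub>j\<close> with the factor
  \<open>\<alpha>\<^sub>i - 1 - 2 \<delta> \<equiv> - (k + 1 + \<delta>)\<close>, so \<open>\<sigma>\<^sub>i\<close> reaches it unless \<open>k \<equiv> - 1 - \<delta>\<close> modulo \<open>p\<close>.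
  In that exceptional case bracketing with \<open>X\<^sub>i\<^sup>p \<partial>\<^sub>i\<close> produces it from another resonant term, on
  which \<open>D\<^sub>i\<close> acts trivially, so that \<open>\<tau>\<^sub>i\<close> reaches it, with the factor
  \<open>\<alpha>\<^sub>i - (p - 1) \<equiv> 2 + 2 \<delta>\<close>, which is 2 or 4 and hence invertible as \<open>p \<ge> 5\<close>.
\<close>


section \<open>The filtration by order\<close>

text \<open>
  The powers of the augmentation ideal, described by vanishing coefficients so that membership
  can be checked degree by degree; \<open>mps_ideal_power_eq\<close> below makes the identification.
\<close>

definition adic :: "nat \<Rightarrow> ('a::comm_ring_1, 'n) mps set" where
  "adic k = {f. \<forall>m. size m < k \<longrightarrow> mps_coeff f m = 0}"

lemma adicI: "(\<And>m. size m < k \<Longrightarrow> mps_coeff f m = 0) \<Longrightarrow> f \<in> adic k"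
  by (simp add: adic_def)

lemma adicD: "f \<in> adic k \<Longrightarrow> size m < k \<Longrightarrow> mps_coeff f m = 0"
  by (simp add: adic_def)

lemma adic_0 [simp]: "f \<in> adic 0"
  by (simp add: adic_def)

lemma zero_adic [simp]: "0 \<in> adic k"
  by (simp add: adic_def zero_mps.rep_eq)

lemma adic_mono: "f \<in> adic k \<Longrightarrow> l \<le> k \<Longrightarrow> f \<in> adic l"
  by (simp add: adic_def)

lemma adic_add: "f \<in> adic k \<Longrightarrow> g \<in> adic k \<Longrightarrow> f + g \<in> adic k"
  by (simp add: adic_def plus_mps.rep_eq)

lemma adic_uminus: "f \<in> adic k \<Longrightarrow> - f \<in> adic k"
  by (simp add: adic_def uminus_mps.rep_eq)

lemma adic_diff: "f \<in> adic k \<Longrightarrow> g \<in> adic k \<Longrightarrow> f - g \<in> adic k"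
  by (simp add: adic_def minus_mps.rep_eq)

lemma adic_diff_trans: "f - g \<in> adic k \<Longrightarrow> g - h \<in> adic k \<Longrightarrow> f - h \<in> adic k"
  using adic_add[of "f - g" k "g - h"] by simp

lemma adic_sum: "(\<And>i. i \<in> I \<Longrightarrow> f i \<in> adic k) \<Longrightarrow> (\<Sum>i\<in>I. f i) \<in> adic k"
  by (induction I rule: infinite_finite_induct) (auto intro: adic_add)

lemma adic_mult:
  fixes f g :: "('a::comm_ring_1, 'n) mps"
  assumes "f \<in> adic k" "g \<in> adic l"
  shows "f * g \<in> adic (k + l)"
proof (rule adicI)
  fix m :: "'n multiset"
  assume m: "size m < k + l"
  have "mps_coeff f n * mps_coeff g (m - n) = 0" if "n \<subseteq># m" for n
  proof (cases "size n < k")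
    case True
    then show ?thesis using adicD[OF assms(1)] by simp
  next
    case False
    have "size (m - n) < l"
      using m False that size_mset_mono[OF that] by (simp add: size_Diff_submset)
    then show ?thesis using adicD[OF assms(2)] by simp
  qed
  then show "mps_coeff (f * g) m = 0"
    by (simp add: times_mps.rep_eq)
qed

lemma adic_mult_left: "f \<in> adic k \<Longrightarrow> g * f \<in> adic k"
  using adic_mult[of g 0 f k] by simp

lemma adic_separated: "(\<And>k. f \<in> adic k) \<Longrightarrow> f = 0"
proof (rule mps_eqI)
  fix m
  assume "\<And>k. f \<in> adic k"
  then show "mps_coeff f m = mps_coeff 0 m"
    using adicD[of f "Suc (size m)" m] by (simp add: zero_mps.rep_eq)
qed

text \<open>The coefficient at \<open>m\<close> no longer changes once the index exceeds the degree of \<open>m\<close>.\<close>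

lemma adic_complete:
  fixes s :: "nat \<Rightarrow> ('a::comm_ring_1, 'n) mps"
  assumes "\<And>N. s (Suc N) - s N \<in> adic N"
  shows "\<exists>g. \<forall>N. g - s N \<in> adic N"
proof -
  define g where "g = Abs_mps (\<lambda>m. mps_coeff (s (Suc (size m))) m)"
  have g: "mps_coeff g m = mps_coeff (s (Suc (size m))) m" for m
    by (simp add: g_def Abs_mps_inverse)
  have eq: "mps_coeff (s N) m = mps_coeff (s (Suc (size m))) m" if "size m < N" for N m
    using that
  proof (induction N)
    case (Suc N)
    show ?case
    proof (cases "N = size m")
      case False
      then have "size m < N" using Suc.prems by simp
      with Suc.IH adicD[OF assms[of N], of m] show ?thesis
        by (simp add: minus_mps.rep_eq)
    qed simp
  qed simp
  have "g - s N \<in> adic N" for N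
  proof (rule adicI)
    fix m :: "'n multiset"
    assume "size m < N"
    from eq[OF this] show "mps_coeff (g - s N) m = 0"
      by (simp add: minus_mps.rep_eq g)
  qed
  then show ?thesis by blast
qed

lift_definition mps_term :: "'a::comm_ring_1 \<Rightarrow> 'n multiset \<Rightarrow> ('a, 'n) mps"
  is "\<lambda>c a m. if m = a then c else 0" .

lemma mps_const_eq_term: "mps_const c = mps_term c {#}"
  by (rule mps_eqI) (simp add: mps_const.rep_eq mps_term.rep_eq)

lemma mps_X_eq_term: "mps_X i = mps_term 1 {#i#}"
  by (rule mps_eqI) (simp add: mps_X.rep_eq mps_term.rep_eq)

lemma mps_term_0 [simp]: "mps_term 0 a = 0"
  by (rule mps_eqI) (simp add: zero_mps.rep_eq mps_term.rep_eq)

lemma mps_term_add: "mps_term (c + d) a = mps_term c a + mps_term d a"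
  by (rule mps_eqI) (simp add: plus_mps.rep_eq mps_term.rep_eq)

lemma mps_term_diff: "mps_term (c - d) a = mps_term c a - mps_term d a"
  by (rule mps_eqI) (simp add: minus_mps.rep_eq mps_term.rep_eq)

lemma mps_term_adic: "k \<le> size a \<Longrightarrow> mps_term c a \<in> adic k"
  by (rule adicI) (auto simp: mps_term.rep_eq)

lemma coeff_term_mult:
  "mps_coeff (mps_term c a * f) m = (if a \<subseteq># m then c * mps_coeff f (m - a) else 0)"
proof -
  have "mps_coeff (mps_term c a * f) m
      = (\<Sum>k | k \<subseteq># m. if k = a then c * mps_coeff f (m - a) else 0)"
    unfolding times_mps.rep_eq mps_term.rep_eq by (intro sum.cong) auto
  then show ?thesis
    by (simp add: finite_submultisets)
qed

lemma mps_term_mult: "mps_term c a * mps_term d b = mps_term (c * d) (a + b)"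
proof (rule mps_eqI)
  fix m
  have "a \<subseteq># m \<and> m - a = b \<longleftrightarrow> m = a + b"
    by (auto simp: subset_mset.add_diff_inverse)
  then show "mps_coeff (mps_term c a * mps_term d b) m = mps_coeff (mps_term (c * d) (a + b)) m"
    by (auto simp: coeff_term_mult mps_term.rep_eq)
qed

lemma coeff_const_mult: "mps_coeff (mps_const c * f) m = c * mps_coeff f m"
  by (simp add: mps_const_eq_term coeff_term_mult)

lemma mps_const_1: "mps_const 1 = 1"
  by (rule mps_eqI) (simp add: mps_const.rep_eq one_mps.rep_eq)

lemma const_mult_term: "mps_const c * mps_term d b = mps_term (c * d) b"
  by (simp add: mps_const_eq_term mps_term_mult)

lemma mps_coeff_sum: "mps_coeff (\<Sum>i\<in>I. f i) m = (\<Sum>i\<in>I. mps_coeff (f i) m)"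
  by (induction I rule: infinite_finite_induct) (auto simp: plus_mps.rep_eq zero_mps.rep_eq)

lemma mps_X_adic: "mps_X i \<in> adic (Suc 0)"
  by (simp add: mps_X_eq_term mps_term_adic)

lemma minus_const_adic: "f - mps_const (mps_coeff f {#}) \<in> adic (Suc 0)"
  by (rule adicI) (simp add: minus_mps.rep_eq mps_const.rep_eq)

lemma finite_size_le: "finite {a::'n::finite multiset. size a \<le> N}"
proof (rule finite_subset)
  show "{a::'n multiset. size a \<le> N} \<subseteq> mset ` {xs. set xs \<subseteq> UNIV \<and> length xs \<le> N}"
  proof
    fix a :: "'n multiset"
    assume a: "a \<in> {a. size a \<le> N}"
    obtain xs where "a = mset xs" by (metis ex_mset)
    with a show "a \<in> mset ` {xs. set xs \<subseteq> UNIV \<and> length xs \<le> N}" by auto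
  qed
  show "finite (mset ` {xs::'n list. set xs \<subseteq> UNIV \<and> length xs \<le> N})"
    by (intro finite_imageI finite_lists_length_le) simp
qed

lemma finite_size_eq: "finite {a::'n::finite multiset. size a = N}"
  by (rule finite_subset[OF _ finite_size_le[of N]]) auto

lemma adic_minus_terms:
  fixes f :: "('a::comm_ring_1, 'n::finite) mps"
  assumes "f \<in> adic k"
  shows "f - (\<Sum>a | size a = k. mps_term (mps_coeff f a) a) \<in> adic (Suc k)"
proof (rule adicI)
  fix m :: "'n multiset"
  assume m: "size m < Suc k"
  have "mps_coeff (\<Sum>a | size a = k. mps_term (mps_coeff f a) a) m
      = (\<Sum>a | size a = k. if m = a then mps_coeff f m else 0)"
    unfolding mps_coeff_sum mps_term.rep_eq by (intro sum.cong) auto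
  also have "\<dots> = (if size m = k then mps_coeff f m else 0)"
    by (simp add: finite_size_eq)
  also have "\<dots> = mps_coeff f m"
    using m adicD[OF assms, of m] by auto
  finally show "mps_coeff (f - (\<Sum>a | size a = k. mps_term (mps_coeff f a) a)) m = 0"
    by (simp add: minus_mps.rep_eq)
qed

text \<open>
  Each nonconstant monomial is assigned to one variable \<open>v m\<close> that it contains, and the monomials
  assigned to \<open>i\<close> are collected in \<open>X\<^sub>i g\<^sub>i\<close>. The decomposition shows that the variables generate the
  ideal, and it is the induction step for statements about endomorphisms.
\<close>

lemma adic_Suc_decomp:
  fixes f :: "('a::comm_ring_1, 'n::finite) mps"
  assumes "f \<in> adic (Suc k)"
  shows "\<exists>g. (\<forall>i. g i \<in> adic k) \<and> f = (\<Sum>i\<in>UNIV. mps_X i * g i)"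
proof -
  define v :: "'n multiset \<Rightarrow> 'n" where "v m = (SOME i. i \<in># m)" for m
  have v: "v m \<in># m" if "m \<noteq> {#}" for m
    unfolding v_def using that by (rule someI_ex[OF multiset_nonemptyE]) blast
  define g where "g i = Abs_mps (\<lambda>m. if v (add_mset i m) = i then mps_coeff f (add_mset i m) else 0)" for i
  have g: "mps_coeff (g i) m = (if v (add_mset i m) = i then mps_coeff f (add_mset i m) else 0)" for i m
    by (simp add: g_def Abs_mps_inverse)
  have "g i \<in> adic k" for i
    by (rule adicI) (auto simp: g intro: adicD[OF assms])
  moreover have "f = (\<Sum>i\<in>UNIV. mps_X i * g i)"
  proof (rule mps_eqI)
    fix m
    have "mps_coeff (mps_X i * g i) m = (if i = v m then (if m = {#} then 0 else mps_coeff f m) else 0)" for i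
      using v[of m] by (auto simp: mps_X_eq_term coeff_term_mult g)
    then have "mps_coeff (\<Sum>i\<in>UNIV. mps_X i * g i) m = (if m = {#} then 0 else mps_coeff f m)"
      by (simp add: mps_coeff_sum)
    then show "mps_coeff f m = mps_coeff (\<Sum>i\<in>UNIV. mps_X i * g i) m"
      using adicD[OF assms, of "{#}"] by auto
  qed
  ultimately show ?thesis by blast
qed

lemma mps_ideal_eq: "mps_ideal = (adic (Suc 0) :: ('a::comm_ring_1, 'n::finite) mps set)"
proof -
  let ?R = "ring_of_type_algebra :: ('a, 'n) mps ring"
  interpret alg: cring ?R by (rule cring_from_type_algebra)
  have R: "ring ?R" by (rule ring_from_type_algebra)
  have "ideal (adic (Suc 0)) ?R"
  proof (rule idealI)
    show "subgroup (adic (Suc 0)) (add_monoid ?R)"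
    proof (rule group.subgroupI)
      show "Group.group (add_monoid ?R)" by (rule abelian_group.a_group[OF ring.is_abelian_group[OF R]])
    next
      fix a assume "a \<in> (adic (Suc 0) :: ('a, 'n) mps set)"
      moreover have "inv\<^bsub>add_monoid ?R\<^esub> a = - a"
        by (rule group.inv_equality[OF abelian_group.a_group[OF ring.is_abelian_group[OF R]]])
           (simp_all add: ring_of_type_algebra_def)
      ultimately show "inv\<^bsub>add_monoid ?R\<^esub> a \<in> adic (Suc 0)" by (simp add: adic_uminus)
    next
      show "adic (Suc 0) \<noteq> ({} :: ('a, 'n) mps set)" using zero_adic by blast
    qed (simp_all add: ring_of_type_algebra_def adic_add)
  next
    fix a x assume a: "a \<in> (adic (Suc 0) :: ('a, 'n) mps set)"
    show "x \<otimes>\<^bsub>?R\<^esub> a \<in> adic (Suc 0)"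
      using adic_mult_left[OF a, of x] by (simp add: ring_of_type_algebra_def)
    show "a \<otimes>\<^bsub>?R\<^esub> x \<in> adic (Suc 0)"
      using adic_mult_left[OF a, of x] by (simp add: ring_of_type_algebra_def mult.commute)
  qed (rule R)
  moreover have "range mps_X \<subseteq> (adic (Suc 0) :: ('a, 'n) mps set)"
    by (auto simp: mps_X_adic)
  ultimately have "mps_ideal \<subseteq> (adic (Suc 0) :: ('a, 'n) mps set)"
    unfolding mps_ideal_def by (rule alg.genideal_minimal)
  moreover have "f \<in> mps_ideal" if mem: "f \<in> adic (Suc 0)" for f :: "('a, 'n) mps"
  proof -
    have id: "ideal mps_ideal ?R"
      unfolding mps_ideal_def by (rule alg.genideal_ideal) (simp add: ring_of_type_algebra_def)
    obtain g where f: "f = (\<Sum>i\<in>UNIV. mps_X i * g i)"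
      using adic_Suc_decomp[OF mem] by blast
    have "mps_X i \<in> (mps_ideal :: ('a, 'n) mps set)" for i
      unfolding mps_ideal_def
      using alg.genideal_self[of "range mps_X"] by (auto simp: ring_of_type_algebra_def)
    then have X: "mps_X i * g i \<in> mps_ideal" for i
      using ideal.I_r_closed[OF id, of "mps_X i" "g i"] by (simp add: ring_of_type_algebra_def)
    have zero: "0 \<in> (mps_ideal :: ('a, 'n) mps set)"
      using additive_subgroup.zero_closed[OF ideal.axioms(1)[OF id]] by (simp add: ring_of_type_algebra_def)
    have add: "a + b \<in> mps_ideal" if "a \<in> mps_ideal" "b \<in> mps_ideal" for a b :: "('a, 'n) mps"
      using additive_subgroup.a_closed[OF ideal.axioms(1)[OF id] that] by (simp add: ring_of_type_algebra_def)
    have "(\<Sum>i\<in>I. mps_X i * g i) \<in> mps_ideal" if "finite I" for I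
      using that by induction (auto simp: zero add X)
    then show ?thesis by (simp add: f)
  qed
  ultimately show ?thesis by blast
qed

lemma mps_ideal_power_eq: "mps_ideal_power k = (adic k :: ('a::comm_ring_1, 'n::finite) mps set)"
proof (induction k)
  case 0
  then show ?case by auto
next
  case (Suc k)
  let ?R = "ring_of_type_algebra :: ('a, 'n) mps ring"
  let ?P = "ideal_prod ?R (adic (Suc 0)) (adic k)"
  have "f \<in> adic (Suc k)" if "f \<in> ?P" for f
    using that
  proof induction
    case (prod i j)
    then show ?case using adic_mult[of i "Suc 0" j k] by (simp add: ring_of_type_algebra_def)
  next
    case (sum s1 s2)
    then show ?case by (simp add: ring_of_type_algebra_def adic_add)
  qed
  moreover have "f \<in> ?P" if mem: "f \<in> adic (Suc k)" for f
  proof -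
    obtain g where g: "\<And>i. g i \<in> adic k" and f: "f = (\<Sum>i\<in>UNIV. mps_X i * g i)"
      using adic_Suc_decomp[OF mem] by blast
    have X: "mps_X i * g i \<in> ?P" for i
      using ideal_prod.prod[of "mps_X i" "adic (Suc 0)" "g i" "adic k" ?R] g
      by (simp add: mps_X_adic ring_of_type_algebra_def)
    have zero: "0 \<in> ?P"
      using ideal_prod.prod[of 0 "adic (Suc 0)" 0 "adic k" ?R] by (simp add: ring_of_type_algebra_def)
    have add: "a + b \<in> ?P" if "a \<in> ?P" "b \<in> ?P" for a b
      using ideal_prod.sum[OF that] by (simp add: ring_of_type_algebra_def)
    have "(\<Sum>i\<in>I. mps_X i * g i) \<in> ?P" if "finite I" for I
      using that by induction (auto simp: zero add X)
    then show ?thesis by (simp add: f)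
  qed
  ultimately show ?case
    by (auto simp: Suc.IH mps_ideal_eq)
qed

section \<open>Augmented algebra endomorphisms\<close>

definition aug_hom :: "(('a::comm_ring_1, 'n::finite) mps \<Rightarrow> ('a, 'n) mps) \<Rightarrow> bool" where
  "aug_hom \<phi> \<longleftrightarrow> (\<forall>f g. \<phi> (f + g) = \<phi> f + \<phi> g) \<and> (\<forall>f g. \<phi> (f * g) = \<phi> f * \<phi> g) \<and>
     (\<forall>c. \<phi> (mps_const c) = mps_const c) \<and> (\<forall>i. \<phi> (mps_X i) \<in> adic (Suc 0))"

text \<open>Such maps are automatically continuous, hence they are exactly the elements of the group \<open>GA\<close>;
  see \<open>carrier_GA_iff\<close>.\<close>

definition aug_aut :: "(('a::comm_ring_1, 'n::finite) mps \<Rightarrow> ('a, 'n) mps) \<Rightarrow> bool" where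
  "aug_aut \<phi> \<longleftrightarrow> aug_hom \<phi> \<and> bij \<phi>"

lemma aug_hom_add: "aug_hom \<phi> \<Longrightarrow> \<phi> (f + g) = \<phi> f + \<phi> g"
  by (simp add: aug_hom_def)

lemma aug_hom_mult: "aug_hom \<phi> \<Longrightarrow> \<phi> (f * g) = \<phi> f * \<phi> g"
  by (simp add: aug_hom_def)

lemma aug_hom_const: "aug_hom \<phi> \<Longrightarrow> \<phi> (mps_const c) = mps_const c"
  by (simp add: aug_hom_def)

lemma aug_hom_X: "aug_hom \<phi> \<Longrightarrow> \<phi> (mps_X i) \<in> adic (Suc 0)"
  by (simp add: aug_hom_def)

lemma aug_hom_zero: "aug_hom \<phi> \<Longrightarrow> \<phi> 0 = 0"
  using aug_hom_add[of \<phi> 0 0] by simp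

lemma aug_hom_diff: "aug_hom \<phi> \<Longrightarrow> \<phi> (f - g) = \<phi> f - \<phi> g"
  using aug_hom_add[of \<phi> "f - g" g] by (simp add: algebra_simps)

lemma aug_hom_sum: "aug_hom \<phi> \<Longrightarrow> \<phi> (\<Sum>i\<in>I. f i) = (\<Sum>i\<in>I. \<phi> (f i))"
  by (induction I rule: infinite_finite_induct) (auto simp: aug_hom_zero aug_hom_add)

lemma aug_hom_adic:
  assumes \<phi>: "aug_hom \<phi>" and "f \<in> adic k"
  shows "\<phi> f \<in> adic k"
  using assms(2)
proof (induction k arbitrary: f)
  case (Suc k)
  obtain g where g: "\<And>i. g i \<in> adic k" and f: "f = (\<Sum>i\<in>UNIV. mps_X i * g i)"
    using adic_Suc_decomp[OF Suc.prems] by blast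
  have "\<phi> (mps_X i) * \<phi> (g i) \<in> adic (Suc k)" for i
    using adic_mult[OF aug_hom_X[OF \<phi>] Suc.IH[OF g]] by simp
  then show ?case
    by (simp add: f aug_hom_sum[OF \<phi>] aug_hom_mult[OF \<phi>] adic_sum)
qed simp

lemma aug_hom_comp: "aug_hom \<phi> \<Longrightarrow> aug_hom \<psi> \<Longrightarrow> aug_hom (\<phi> \<circ> \<psi>)"
  using aug_hom_adic[of \<phi>] by (simp add: aug_hom_def)

lemma aug_hom_id: "aug_hom id"
  by (simp add: aug_hom_def mps_X_adic)

text \<open>
  Two endomorphisms that agree on the variables to order \<open>d + 1\<close> differ by a map that raises the
  order by \<open>d\<close>. This replaces the density of polynomials: it bounds the effect on arbitrary series
  by the effect on the variables, and for all \<open>d\<close> at once it gives uniqueness.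
\<close>

lemma aug_hom_diff_adic:
  assumes \<phi>: "aug_hom \<phi>" and \<psi>: "aug_hom \<psi>"
    and X: "\<And>i. \<phi> (mps_X i) - \<psi> (mps_X i) \<in> adic (Suc d)"
  shows "\<phi> f - \<psi> f \<in> adic (Suc d)"
    and "f \<in> adic k \<Longrightarrow> \<phi> f - \<psi> f \<in> adic (k + d)"
proof -
  have prod: "\<phi> (mps_X i * g) - \<psi> (mps_X i * g)
      = (\<phi> (mps_X i) - \<psi> (mps_X i)) * \<phi> g + \<psi> (mps_X i) * (\<phi> g - \<psi> g)" for i g
    by (simp add: aug_hom_mult[OF \<phi>] aug_hom_mult[OF \<psi>] algebra_simps)
  have "\<phi> f - \<psi> f \<in> adic N" if "N \<le> Suc d" for N f
    using that
  proof (induction N arbitrary: f)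
    case (Suc N)
    define f1 where "f1 = f - mps_const (mps_coeff f {#})"
    have "f1 \<in> adic (Suc 0)"
      unfolding f1_def by (rule minus_const_adic)
    then obtain g where f1: "f1 = (\<Sum>i\<in>UNIV. mps_X i * g i)"
      using adic_Suc_decomp by blast
    have "\<phi> f - \<psi> f = \<phi> f1 - \<psi> f1"
      by (simp add: f1_def aug_hom_diff[OF \<phi>] aug_hom_diff[OF \<psi>] aug_hom_const[OF \<phi>] aug_hom_const[OF \<psi>])
    also have "\<dots> = (\<Sum>i\<in>UNIV. \<phi> (mps_X i * g i) - \<psi> (mps_X i * g i))"
      by (simp add: f1 aug_hom_sum[OF \<phi>] aug_hom_sum[OF \<psi>] sum_subtractf)
    also have "\<dots> \<in> adic (Suc N)"
    proof (rule adic_sum)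
      fix i :: 'b
      have "(\<phi> (mps_X i) - \<psi> (mps_X i)) * \<phi> (g i) \<in> adic (Suc N)"
        using adic_mult[OF X[of i], of "\<phi> (g i)" 0] Suc.prems adic_mono by fastforce
      moreover have "\<psi> (mps_X i) * (\<phi> (g i) - \<psi> (g i)) \<in> adic (Suc N)"
        using adic_mult[OF aug_hom_X[OF \<psi>, of i] Suc.IH[of "g i"]] Suc.prems by simp
      ultimately show "\<phi> (mps_X i * g i) - \<psi> (mps_X i * g i) \<in> adic (Suc N)"
        unfolding prod by (rule adic_add)
    qed
    finally show ?case .
  qed simp
  then show gen: "\<phi> f - \<psi> f \<in> adic (Suc d)" for f by blast
  show "\<phi> f - \<psi> f \<in> adic (k + d)" if "f \<in> adic k"
    using that
  proof (induction k arbitrary: f)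
    case 0
    then show ?case using gen[of f] adic_mono[of _ "Suc d" d] by simp
  next
    case (Suc k)
    obtain g where g: "\<And>i. g i \<in> adic k" and f: "f = (\<Sum>i\<in>UNIV. mps_X i * g i)"
      using adic_Suc_decomp[OF Suc.prems] by blast
    have "\<phi> f - \<psi> f = (\<Sum>i\<in>UNIV. \<phi> (mps_X i * g i) - \<psi> (mps_X i * g i))"
      by (simp add: f aug_hom_sum[OF \<phi>] aug_hom_sum[OF \<psi>] sum_subtractf)
    also have "\<dots> \<in> adic (Suc k + d)"
    proof (rule adic_sum)
      fix i :: 'b
      have "(\<phi> (mps_X i) - \<psi> (mps_X i)) * \<phi> (g i) \<in> adic (Suc k + d)"
        using adic_mult[OF X[of i] aug_hom_adic[OF \<phi> g[of i]]] by (simp add: add.commute)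
      moreover have "\<psi> (mps_X i) * (\<phi> (g i) - \<psi> (g i)) \<in> adic (Suc k + d)"
        using adic_mult[OF aug_hom_X[OF \<psi>, of i] Suc.IH[OF g[of i]]] by simp
      ultimately show "\<phi> (mps_X i * g i) - \<psi> (mps_X i * g i) \<in> adic (Suc k + d)"
        unfolding prod by (rule adic_add)
    qed
    finally show ?case .
  qed
qed

lemma aug_hom_eqI:
  assumes "aug_hom \<phi>" and "aug_hom \<psi>" and "\<And>i. \<phi> (mps_X i) = \<psi> (mps_X i)"
  shows "\<phi> = \<psi>"
proof
  fix f
  have "\<phi> f - \<psi> f \<in> adic k" for k
    using aug_hom_diff_adic(1)[OF assms(1,2), of k f] assms(3) adic_mono[of _ "Suc k" k] by simp
  then show "\<phi> f = \<psi> f"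
    using adic_separated by force
qed

text \<open>The usual notation for inverse functions is taken by the inverse in a group.\<close>

abbreviation aut_inv :: "('b \<Rightarrow> 'b) \<Rightarrow> 'b \<Rightarrow> 'b" where
  "aut_inv \<equiv> inv_into UNIV"

lemma aug_aut_hom: "aug_aut \<phi> \<Longrightarrow> aug_hom \<phi>"
  by (simp add: aug_aut_def)

lemma aug_aut_comp: "aug_aut \<phi> \<Longrightarrow> aug_aut \<psi> \<Longrightarrow> aug_aut (\<phi> \<circ> \<psi>)"
  by (simp add: aug_aut_def aug_hom_comp bij_comp)

lemma aug_aut_id: "aug_aut id"
  by (simp add: aug_aut_def aug_hom_id)

lemma aug_aut_inv_right: "aug_aut \<phi> \<Longrightarrow> \<phi> (aut_inv \<phi> f) = f"
  by (simp add: aug_aut_def bij_is_surj surj_f_inv_f)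

lemma aug_aut_inv_left: "aug_aut \<phi> \<Longrightarrow> aut_inv \<phi> (\<phi> f) = f"
  by (simp add: aug_aut_def bij_is_inj)

lemma aug_aut_inv:
  fixes \<phi> :: "('a::comm_ring_1, 'b::finite) mps \<Rightarrow> ('a, 'b) mps"
  assumes "aug_aut \<phi>"
  shows "aug_aut (aut_inv \<phi>)"
proof -
  note \<phi> = aug_aut_hom[OF assms]
  note r = aug_aut_inv_right[OF assms] and l = aug_aut_inv_left[OF assms]
  have "aut_inv \<phi> (f + g) = aut_inv \<phi> f + aut_inv \<phi> g" for f g
    using l[of "aut_inv \<phi> f + aut_inv \<phi> g"] by (simp add: aug_hom_add[OF \<phi>] r)
  moreover have "aut_inv \<phi> (f * g) = aut_inv \<phi> f * aut_inv \<phi> g" for f g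
    using l[of "aut_inv \<phi> f * aut_inv \<phi> g"] by (simp add: aug_hom_mult[OF \<phi>] r)
  moreover have "aut_inv \<phi> (mps_const c) = mps_const c" for c
    using l[of "mps_const c"] by (simp add: aug_hom_const[OF \<phi>])
  moreover have "aut_inv \<phi> (mps_X i) \<in> adic (Suc 0)" for i
  proof -
    let ?f = "aut_inv \<phi> (mps_X i)" and ?c = "mps_const (mps_coeff (aut_inv \<phi> (mps_X i)) {#}) :: ('a, 'b) mps"
    have "\<phi> ?f - \<phi> ?c \<in> adic (Suc 0)"
      using aug_hom_adic[OF \<phi> minus_const_adic] by (simp add: aug_hom_diff[OF \<phi>])
    then have "mps_X i - ?c \<in> adic (Suc 0)"
      by (simp add: r aug_hom_const[OF \<phi>])
    from adic_diff[OF mps_X_adic[of i] this] have "?c \<in> adic (Suc 0)"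
      by simp
    from adic_add[OF minus_const_adic[of ?f] this] show ?thesis
      by simp
  qed
  ultimately have "aug_hom (aut_inv \<phi>)"
    by (simp add: aug_hom_def)
  then show ?thesis
    using assms by (simp add: aug_aut_def bij_imp_bij_inv)
qed

lemma aug_hom_continuous:
  fixes \<phi> :: "('a::comm_ring_1, 'b::finite) mps \<Rightarrow> ('a, 'b) mps"
  assumes "aug_hom \<phi>"
  shows "continuous_map mps_adic_topology mps_adic_topology \<phi>"
proof -
  define B where "B = {(+) f ` adic k |(f :: ('a, 'b) mps) k. True}"
  have top: "mps_adic_topology = topology_generated_by B"
    by (simp add: mps_adic_topology_def mps_ideal_power_eq B_def)
  have "f \<in> (+) f ` adic k" for f :: "('a, 'b) mps" and k
    using zero_adic by force
  then have UN: "\<Union>B = UNIV" unfolding B_def by blast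
  have mem: "g \<in> (+) f ` adic k \<longleftrightarrow> g - f \<in> adic k" for f g :: "('a, 'b) mps" and k
    by (auto simp: image_iff intro!: bexI[of _ "g - f"])
  show ?thesis
    unfolding top
  proof (rule continuous_on_generated_topo)
    fix U assume "U \<in> B"
    then obtain f k where U: "U = (+) f ` adic k" unfolding B_def by blast
    have "\<phi> -` U = \<Union> {(+) g ` adic k |g. \<phi> g \<in> U}"
    proof (intro equalityI subsetI)
      fix g assume "g \<in> \<phi> -` U"
      moreover have "g \<in> (+) g ` adic k" by (simp add: mem)
      ultimately show "g \<in> \<Union> {(+) g ` adic k |g. \<phi> g \<in> U}" by blast
    next
      fix h assume "h \<in> \<Union> {(+) g ` adic k |g. \<phi> g \<in> U}"
      then obtain g where "h \<in> (+) g ` adic k" "\<phi> g \<in> U" by blast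
      then have "h - g \<in> adic k" "\<phi> g - f \<in> adic k" by (simp_all add: mem U)
      then have "\<phi> (h - g) + (\<phi> g - f) \<in> adic k"
        by (intro adic_add aug_hom_adic[OF assms])
      then show "h \<in> \<phi> -` U"
        by (simp add: U mem aug_hom_diff[OF assms])
    qed
    moreover have "openin (topology_generated_by B) (\<Union> {(+) g ` adic k |g. \<phi> g \<in> U})"
      by (rule openin_Union) (auto simp: B_def intro: topology_generated_by_Basis)
    ultimately show "openin (topology_generated_by B) (\<phi> -` U \<inter> topspace (topology_generated_by B))"
      by (simp add: UN)
  qed (simp add: UN)
qed

lemma carrier_GA_iff:
  fixes R :: "'a::comm_ring_1 itself" and N :: "'n::finite itself"
  shows "\<phi> \<in> carrier (GA R N) \<longleftrightarrow> aug_aut \<phi>"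
proof
  assume \<phi>: "\<phi> \<in> carrier (GA R N)"
  then have "aug_hom \<phi>"
    by (auto simp: mps_X_adic GA_def mps_algebra_aut_def ring_hom_def ring_of_type_algebra_def
        aug_hom_def mps_ideal_eq image_subset_iff)
  with \<phi> show "aug_aut \<phi>"
    by (simp add: aug_aut_def GA_def mps_algebra_aut_def)
next
  assume \<phi>: "aug_aut \<phi>"
  have "\<phi> 1 = 1"
    using aug_hom_const[OF aug_aut_hom[OF \<phi>], of 1] by (simp add: mps_const_1)
  then show "\<phi> \<in> carrier (GA R N)"
    using \<phi> aug_aut_hom[OF \<phi>] aug_hom_continuous[OF aug_aut_hom[OF \<phi>]] aug_hom_adic[OF aug_aut_hom[OF \<phi>]]
    by (auto simp: GA_def mps_algebra_aut_def ring_hom_def ring_of_type_algebra_def aug_aut_def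
        aug_hom_add aug_hom_mult aug_hom_const mps_ideal_eq)
qed

lemma mult_GA: "\<phi> \<otimes>\<^bsub>GA R N\<^esub> \<psi> = \<phi> \<circ> \<psi>"
  by (simp add: GA_def)

lemma one_GA: "\<one>\<^bsub>GA R N\<^esub> = id"
  by (simp add: GA_def)

lemma aut_inv_comp: "aug_aut \<phi> \<Longrightarrow> aut_inv \<phi> \<circ> \<phi> = id"
  by (simp add: fun_eq_iff aug_aut_inv_left)

lemma group_GA: "Group.group (GA R N)"
proof (rule groupI)
  fix \<phi> assume "\<phi> \<in> carrier (GA R N)"
  then show "\<exists>\<psi>\<in>carrier (GA R N). \<psi> \<otimes>\<^bsub>GA R N\<^esub> \<phi> = \<one>\<^bsub>GA R N\<^esub>"
    unfolding carrier_GA_iff mult_GA one_GA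
    by (intro bexI[of _ "aut_inv \<phi>"]) (auto simp: carrier_GA_iff aug_aut_inv aut_inv_comp)
qed (auto simp: carrier_GA_iff mult_GA one_GA aug_aut_comp aug_aut_id comp_assoc)

lemma inv_GA:
  assumes "aug_aut \<phi>"
  shows "inv\<^bsub>GA R N\<^esub> \<phi> = aut_inv \<phi>"
  using assms
  by (intro group.inv_equality[OF group_GA])
    (auto simp: carrier_GA_iff mult_GA one_GA aug_aut_inv aut_inv_comp)

section \<open>Substitution and elementary automorphisms\<close>

definition xpow :: "('n \<Rightarrow> ('a::comm_ring_1, 'n) mps) \<Rightarrow> 'n multiset \<Rightarrow> ('a, 'n) mps" where
  "xpow h a = prod_mset (image_mset h a)"

text \<open>
  If all \<open>h i\<close> have zero constant term, only monomials of degree at most \<open>size m\<close> contribute to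
  the coefficient at \<open>m\<close>, which makes the sum finite.
\<close>

definition subst :: "('n::finite \<Rightarrow> ('a::comm_ring_1, 'n) mps) \<Rightarrow> ('a, 'n) mps \<Rightarrow> ('a, 'n) mps" where
  "subst h f = Abs_mps (\<lambda>m. \<Sum>a | size a \<le> size m. mps_coeff f a * mps_coeff (xpow h a) m)"

lemma xpow_add: "xpow h (a + b) = xpow h a * xpow h b"
  by (simp add: xpow_def)

lemma xpow_adic:
  assumes "\<And>i. h i \<in> adic (Suc 0)"
  shows "xpow h a \<in> adic (size a)"
proof (induction a)
  case (add x a)
  then show ?case
    using adic_mult[OF assms[of x], of "xpow h a" "size a"] by (simp add: xpow_def)
qed simp

lemma coeff_subst:
  assumes h: "\<And>i. h i \<in> adic (Suc 0)" and "size m \<le> N"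
  shows "mps_coeff (subst h f) m = (\<Sum>a | size a \<le> N. mps_coeff f a * mps_coeff (xpow h a) m)"
proof -
  have "mps_coeff (subst h f) m = (\<Sum>a | size a \<le> size m. mps_coeff f a * mps_coeff (xpow h a) m)"
    by (simp add: subst_def Abs_mps_inverse)
  also have "\<dots> = (\<Sum>a | size a \<le> N. mps_coeff f a * mps_coeff (xpow h a) m)"
    using assms(2) adicD[OF xpow_adic[of h, OF h]]
    by (intro sum.mono_neutral_left) (auto simp: finite_size_le)
  finally show ?thesis .
qed

lemma subst_term:
  assumes h: "\<And>i. h i \<in> adic (Suc 0)"
  shows "subst h (mps_term c a) = mps_const c * xpow h a"
proof (rule mps_eqI)
  fix m
  have "mps_coeff (subst h (mps_term c a)) m
      = (\<Sum>b | size b \<le> max (size m) (size a). mps_coeff (mps_term c a) b * mps_coeff (xpow h b) m)"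
    by (rule coeff_subst[OF h]) simp
  also have "\<dots> = (\<Sum>b | size b \<le> max (size m) (size a). if b = a then c * mps_coeff (xpow h a) m else 0)"
    by (intro sum.cong) (auto simp: mps_term.rep_eq)
  also have "\<dots> = c * mps_coeff (xpow h a) m"
    by (simp add: finite_size_le)
  finally show "mps_coeff (subst h (mps_term c a)) m = mps_coeff (mps_const c * xpow h a) m"
    by (simp add: coeff_const_mult)
qed

lemma subst_mult:
  fixes h :: "'n::finite \<Rightarrow> ('a::comm_ring_1, 'n) mps"
  assumes h: "\<And>i. h i \<in> adic (Suc 0)"
  shows "subst h (f * g) = subst h f * subst h g"
proof (rule mps_eqI)
  fix m :: "'n multiset"
  let ?N = "size m" and ?S = "{a. size a \<le> size m}"
  have le: "size k \<le> ?N" "size (m - k) \<le> ?N" if "k \<subseteq># m" for k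
    using size_mset_mono[OF that] size_mset_mono[of "m - k" m] by auto
  have "mps_coeff (subst h f * subst h g) m
      = (\<Sum>k | k \<subseteq># m. \<Sum>a\<in>?S. \<Sum>b\<in>?S. mps_coeff f a * mps_coeff (xpow h a) k
          * (mps_coeff g b * mps_coeff (xpow h b) (m - k)))"
    by (simp add: times_mps.rep_eq coeff_subst[OF h le(1)] coeff_subst[OF h le(2)] sum_product)
  also have "\<dots> = (\<Sum>a\<in>?S. \<Sum>k | k \<subseteq># m. \<Sum>b\<in>?S. mps_coeff f a * mps_coeff (xpow h a) k
          * (mps_coeff g b * mps_coeff (xpow h b) (m - k)))"
    by (rule sum.swap)
  also have "\<dots> = (\<Sum>a\<in>?S. \<Sum>b\<in>?S. \<Sum>k | k \<subseteq># m. mps_coeff f a * mps_coeff (xpow h a) k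
          * (mps_coeff g b * mps_coeff (xpow h b) (m - k)))"
    by (intro sum.cong refl sum.swap)
  also have "\<dots> = (\<Sum>a\<in>?S. \<Sum>b\<in>?S. mps_coeff f a * mps_coeff g b * mps_coeff (xpow h (a + b)) m)"
    by (simp add: xpow_add times_mps.rep_eq sum_distrib_left algebra_simps)
  also have "\<dots> = (\<Sum>(a, b)\<in>?S \<times> ?S. mps_coeff f a * mps_coeff g b * mps_coeff (xpow h (a + b)) m)"
    by (simp add: sum.cartesian_product)
  also have "\<dots> = (\<Sum>(a, b)\<in>{(a, b). size a + size b \<le> size m}.
      mps_coeff f a * mps_coeff g b * mps_coeff (xpow h (a + b)) m)"
  proof (rule sum.mono_neutral_right)
    have "mps_coeff (xpow h (a + b)) m = 0" if "\<not> size a + size b \<le> size m" for a b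
      using adicD[OF xpow_adic[of h, OF h], of m "a + b"] that by simp
    then show "\<forall>x\<in>?S \<times> ?S - {(a, b). size a + size b \<le> size m}.
        (case x of (a, b) \<Rightarrow> mps_coeff f a * mps_coeff g b * mps_coeff (xpow h (a + b)) m) = 0"
      by (intro ballI) (simp add: case_prod_unfold)
  qed (auto simp: finite_size_le)
  also have "\<dots> = (\<Sum>(c, a)\<in>(SIGMA c:?S. {a. a \<subseteq># c}).
      mps_coeff f a * mps_coeff g (c - a) * mps_coeff (xpow h c) m)"
    by (rule sum.reindex_bij_witness[where i = "\<lambda>(c, a). (a, c - a)" and j = "\<lambda>(a, b). (a + b, a)"])
      (auto simp: size_Diff_submset subset_mset.add_diff_inverse size_mset_mono)
  also have "\<dots> = mps_coeff (subst h (f * g)) m"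
    by (simp add: coeff_subst[OF h order_refl] times_mps.rep_eq sum_distrib_right
        sum.Sigma finite_size_le finite_submultisets)
  finally show "mps_coeff (subst h (f * g)) m = mps_coeff (subst h f * subst h g) m" ..
qed

lemma subst_X:
  assumes h: "\<And>i. h i \<in> adic (Suc 0)"
  shows "subst h (mps_X i) = h i"
  by (simp add: mps_X_eq_term subst_term[OF h] xpow_def mps_const_1)

lemma aug_hom_subst:
  assumes h: "\<And>i. h i \<in> adic (Suc 0)"
  shows "aug_hom (subst h)"
  unfolding aug_hom_def
proof (intro conjI allI)
  show "subst h (f + g) = subst h f + subst h g" for f g
    by (rule mps_eqI)
      (simp add: plus_mps.rep_eq coeff_subst[OF h order_refl] sum.distrib distrib_right)
  show "subst h (f * g) = subst h f * subst h g" for f g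
    by (rule subst_mult[OF h])
  show "subst h (mps_const c) = mps_const c" for c
    using subst_term[of h c "{#}", OF h] by (simp add: mps_const_eq_term xpow_def)
  show "subst h (mps_X i) \<in> adic (Suc 0)" for i
    by (simp add: subst_X[OF h] h)
qed

text \<open>
  With \<open>T = id - \<phi>\<close>, which raises the order, the preimage of \<open>f\<close> is the Neumann series
  \<open>f + T f + T (T f) + \<dots>\<close>.
\<close>

lemma aug_hom_bij:
  assumes \<phi>: "aug_hom \<phi>" and X: "\<And>i. \<phi> (mps_X i) - mps_X i \<in> adic 2"
  shows "bij \<phi>"
proof -
  define T where "T f = f - \<phi> f" for f
  have T: "T f \<in> adic (Suc k)" if "f \<in> adic k" for f k
    using aug_hom_diff_adic(2)[OF aug_hom_id \<phi> _ that, of 1] adic_uminus[OF X]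
    by (simp add: T_def numeral_2_eq_2)
  have "inj \<phi>"
  proof (rule injI)
    fix f g assume eq: "\<phi> f = \<phi> g"
    have "f - g \<in> adic k" for k
    proof (induction k)
      case (Suc k)
      have "T (f - g) = f - g" by (simp add: T_def aug_hom_diff[OF \<phi>] eq)
      then show ?case using T[OF Suc] by simp
    qed simp
    then show "f = g" using adic_separated by force
  qed
  moreover have "\<exists>g. \<phi> g = f" for f
  proof -
    define s where "s N = (\<Sum>k<N. (T ^^ k) f)" for N
    have Tk: "(T ^^ k) f \<in> adic k" for k
      by (induction k) (auto intro: T)
    then obtain g where g: "\<And>N. g - s N \<in> adic N"
      using adic_complete[of s] by (auto simp: s_def)
    have \<phi>s: "f - \<phi> (s N) = (T ^^ N) f" for N
    proof (induction N)
      case 0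
      then show ?case by (simp add: s_def aug_hom_zero[OF \<phi>])
    next
      case (Suc N)
      have "f - \<phi> (s (Suc N)) = f - \<phi> (s N) - \<phi> ((T ^^ N) f)"
        by (simp add: s_def aug_hom_add[OF \<phi>])
      also have "\<dots> = T ((T ^^ N) f)"
        by (simp add: Suc T_def[of "(T ^^ N) f"])
      finally show ?case by simp
    qed
    have "\<phi> g - f \<in> adic N" for N
    proof -
      have "\<phi> (g - s N) - (f - \<phi> (s N)) \<in> adic N"
        unfolding \<phi>s by (intro adic_diff aug_hom_adic[OF \<phi> g] Tk)
      then show ?thesis by (simp add: aug_hom_diff[OF \<phi>])
    qed
    then have "\<phi> g = f" using adic_separated by force
    then show ?thesis ..
  qed
  then have "surj \<phi>"
    unfolding surj_def by metis
  ultimately show ?thesis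
    by (simp add: bij_def)
qed

definition elem_aut :: "'n::finite \<Rightarrow> 'n multiset \<Rightarrow> 'a::comm_ring_1 \<Rightarrow> ('a, 'n) mps \<Rightarrow> ('a, 'n) mps" where
  "elem_aut j a c = subst (\<lambda>l. mps_X l + (if l = j then mps_term c a else 0))"

lemma elem_aut_arg: "size a \<ge> 1 \<Longrightarrow> mps_X l + (if l = j then mps_term c a else 0) \<in> adic (Suc 0)"
  by (auto intro!: adic_add mps_X_adic mps_term_adic)

lemma elem_aut_X:
  "size a \<ge> 1 \<Longrightarrow> elem_aut j a c (mps_X l) = mps_X l + (if l = j then mps_term c a else 0)"
  unfolding elem_aut_def by (rule subst_X) (rule elem_aut_arg)

lemma aug_aut_elem:
  assumes "size a \<ge> 2"
  shows "aug_aut (elem_aut j a c)"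
proof -
  have hom: "aug_hom (elem_aut j a c)"
    unfolding elem_aut_def
  proof (rule aug_hom_subst)
    show "mps_X l + (if l = j then mps_term c a else 0) \<in> adic (Suc 0)" for l
      using assms by (intro elem_aut_arg) simp
  qed
  have "elem_aut j a c (mps_X l) - mps_X l \<in> adic 2" for l
    using assms by (simp add: elem_aut_X mps_term_adic)
  with hom show ?thesis
    unfolding aug_aut_def using aug_hom_bij by blast
qed

definition scale_var :: "'n::finite \<Rightarrow> 'a::comm_ring_1 \<Rightarrow> ('a, 'n) mps \<Rightarrow> ('a, 'n) mps" where
  "scale_var i c f = Abs_mps (\<lambda>m. c ^ count m i * mps_coeff f m)"

lemma coeff_scale_var: "mps_coeff (scale_var i c f) m = c ^ count m i * mps_coeff f m"
  by (simp add: scale_var_def Abs_mps_inverse)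

lemma scale_var_term: "scale_var i c (mps_term d a) = mps_term (c ^ count a i * d) a"
  by (rule mps_eqI) (simp add: coeff_scale_var mps_term.rep_eq)

lemma scale_var_X: "scale_var i c (mps_X l) = mps_term (if l = i then c else 1) {#l#}"
  by (simp add: mps_X_eq_term scale_var_term)

lemma aug_hom_scale_var: "aug_hom (scale_var (i::'b::finite) c)"
  unfolding aug_hom_def
proof (intro conjI allI)
  show "scale_var i c (f + g) = scale_var i c f + scale_var i c g" for f g
    by (rule mps_eqI) (simp add: coeff_scale_var plus_mps.rep_eq distrib_left)
  show "scale_var i c (f * g) = scale_var i c f * scale_var i c g" for f g
  proof (rule mps_eqI)
    fix m :: "'b multiset"
    have "c ^ count m i * (mps_coeff f k * mps_coeff g (m - k))
        = c ^ count k i * mps_coeff f k * (c ^ count (m - k) i * mps_coeff g (m - k))"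
      if "k \<subseteq># m" for k
    proof -
      have "count m i = count k i + count (m - k) i"
        using mset_subset_eq_count[OF that, of i] by simp
      then have "c ^ count m i = c ^ count k i * c ^ count (m - k) i"
        by (simp only: power_add)
      then show ?thesis by (simp only: mult_ac)
    qed
    then show "mps_coeff (scale_var i c (f * g)) m = mps_coeff (scale_var i c f * scale_var i c g) m"
      by (simp add: coeff_scale_var times_mps.rep_eq sum_distrib_left)
  qed
  show "scale_var i c (mps_const d) = mps_const d" for d
    by (simp add: mps_const_eq_term scale_var_term)
  show "scale_var i c (mps_X l) \<in> adic (Suc 0)" for l
    by (simp add: scale_var_X mps_term_adic)
qed

lemma scale_var_inverse: "c * d = 1 \<Longrightarrow> scale_var i c (scale_var i d f) = f"
  by (rule mps_eqI) (simp add: coeff_scale_var mult.assoc[symmetric] power_mult_distrib[symmetric])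

lemma aug_aut_scale_var:
  assumes "c * d = 1"
  shows "aug_aut (scale_var i c)" and "aut_inv (scale_var i c) = scale_var i d"
proof -
  note cd = scale_var_inverse[OF assms] and dc = scale_var_inverse[OF assms[unfolded mult.commute[of c]]]
  have "bij (scale_var i c)"
    by (rule o_bij[of "scale_var i d"]) (auto simp: cd dc)
  then show "aug_aut (scale_var i c)"
    by (simp add: aug_aut_def aug_hom_scale_var)
  show "aut_inv (scale_var i c) = scale_var i d"
    by (rule inv_unique_comp) (auto simp: cd dc)
qed

section \<open>Depth and leading terms of commutators\<close>

definition depth_ge :: "nat \<Rightarrow> (('a::comm_ring_1, 'n::finite) mps \<Rightarrow> ('a, 'n) mps) \<Rightarrow> bool" where
  "depth_ge d \<phi> \<longleftrightarrow> aug_aut \<phi> \<and> (\<forall>i. \<phi> (mps_X i) - mps_X i \<in> adic (Suc d))"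

lemma depth_ge_aut: "depth_ge d \<phi> \<Longrightarrow> aug_aut \<phi>"
  by (simp add: depth_ge_def)

lemma depth_ge_hom: "depth_ge d \<phi> \<Longrightarrow> aug_hom \<phi>"
  by (simp add: depth_ge_def aug_aut_def)

lemma depth_ge_mono: "depth_ge d \<phi> \<Longrightarrow> e \<le> d \<Longrightarrow> depth_ge e \<phi>"
  using adic_mono by (fastforce simp: depth_ge_def)

lemma depth_ge_shift:
  assumes "depth_ge d \<phi>"
  shows "\<phi> f - f \<in> adic (Suc d)" and "f \<in> adic k \<Longrightarrow> \<phi> f - f \<in> adic (k + d)"
  using aug_hom_diff_adic[OF depth_ge_hom[OF assms] aug_hom_id, of d] assms
  by (simp_all add: depth_ge_def)

lemma depth_geI:
  "aug_aut \<phi> \<Longrightarrow> (\<And>i. \<phi> (mps_X i) - mps_X i \<in> adic (Suc d)) \<Longrightarrow> depth_ge d \<phi>"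
  by (simp add: depth_ge_def)

lemma depth_ge_id: "depth_ge d id"
  by (simp add: depth_ge_def aug_aut_id)

lemma depth_ge_comp:
  assumes "depth_ge d \<phi>" "depth_ge d \<psi>"
  shows "depth_ge d (\<phi> \<circ> \<psi>)"
proof (rule depth_geI)
  show "aug_aut (\<phi> \<circ> \<psi>)"
    using assms by (intro aug_aut_comp depth_ge_aut)
  fix i
  show "(\<phi> \<circ> \<psi>) (mps_X i) - mps_X i \<in> adic (Suc d)"
    using adic_add[OF depth_ge_shift(1)[OF assms(1), of "\<psi> (mps_X i)"]
        depth_ge_shift(1)[OF assms(2), of "mps_X i"]] by simp
qed

lemma depth_ge_inv:
  assumes "depth_ge d \<phi>"
  shows "depth_ge d (aut_inv \<phi>)"
proof (rule depth_geI)
  note \<phi> = depth_ge_aut[OF assms]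
  show "aug_aut (aut_inv \<phi>)" by (rule aug_aut_inv[OF \<phi>])
  fix i
  show "aut_inv \<phi> (mps_X i) - mps_X i \<in> adic (Suc d)"
    using adic_uminus[OF depth_ge_shift(1)[OF assms, of "aut_inv \<phi> (mps_X i)"]]
    by (simp add: aug_aut_inv_right[OF \<phi>])
qed

lemma depth_ge_conj:
  assumes "aug_aut \<phi>" "depth_ge d \<psi>"
  shows "depth_ge d (\<phi> \<circ> \<psi> \<circ> aut_inv \<phi>)"
proof (rule depth_geI)
  show "aug_aut (\<phi> \<circ> \<psi> \<circ> aut_inv \<phi>)"
    by (intro aug_aut_comp depth_ge_aut[OF assms(2)] aug_aut_inv assms)
  fix i
  let ?y = "aut_inv \<phi> (mps_X i)"
  have "\<phi> (\<psi> ?y - ?y) \<in> adic (Suc d)"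
    by (rule aug_hom_adic[OF aug_aut_hom[OF assms(1)] depth_ge_shift(1)[OF assms(2)]])
  then show "(\<phi> \<circ> \<psi> \<circ> aut_inv \<phi>) (mps_X i) - mps_X i \<in> adic (Suc d)"
    by (simp add: aug_hom_diff[OF aug_aut_hom[OF assms(1)]] aug_aut_inv_right[OF assms(1)])
qed

lemma depth_ge_elem:
  "size a = Suc d \<Longrightarrow> d \<ge> 1 \<Longrightarrow> depth_ge d (elem_aut j a c)"
  by (intro depth_geI aug_aut_elem) (simp_all add: elem_aut_X mps_term_adic)

lemma GI_iff: "\<phi> \<in> GI R N \<longleftrightarrow> depth_ge 1 \<phi>"
proof
  assume "\<phi> \<in> GI R N"
  then show "depth_ge 1 \<phi>"
    by (auto simp: GI_def carrier_GA_iff mps_ideal_power_eq depth_ge_def numeral_2_eq_2)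
next
  assume "depth_ge 1 \<phi>"
  then show "\<phi> \<in> GI R N"
    using depth_ge_shift(1)[of 1 \<phi>]
    by (auto simp: GI_def carrier_GA_iff mps_ideal_power_eq depth_ge_aut numeral_2_eq_2)
qed

definition aut_comm :: "('b \<Rightarrow> 'b) \<Rightarrow> ('b \<Rightarrow> 'b) \<Rightarrow> 'b \<Rightarrow> 'b" where
  "aut_comm \<phi> \<psi> = \<phi> \<circ> \<psi> \<circ> aut_inv \<phi> \<circ> aut_inv \<psi>"

lemma aug_aut_comm: "aug_aut \<phi> \<Longrightarrow> aug_aut \<psi> \<Longrightarrow> aug_aut (aut_comm \<phi> \<psi>)"
  unfolding aut_comm_def by (intro aug_aut_comp aug_aut_inv)

lemma depth_ge_comm:
  assumes "aug_aut \<phi>" "depth_ge d \<psi>"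
  shows "depth_ge d (aut_comm \<phi> \<psi>)"
  unfolding aut_comm_def by (rule depth_ge_comp[OF depth_ge_conj[OF assms] depth_ge_inv[OF assms(2)]])

text \<open>
  This identity reduces the leading term of a group commutator to that of the operator
  commutator \<open>\<phi> \<psi> - \<psi> \<phi>\<close>.
\<close>

lemma aut_comm_minus_id:
  assumes "aug_aut \<phi>" "aug_aut \<psi>" and y: "y = aut_inv \<phi> (aut_inv \<psi> f)"
  shows "aut_comm \<phi> \<psi> f - f = \<phi> (\<psi> y) - \<psi> (\<phi> y)"
  by (simp add: y aut_comm_def aug_aut_inv_right assms)

text \<open>
  Since \<open>\<phi> \<psi> - \<psi> \<phi>\<close> raises the order by \<open>e\<close>, its argument matters only modulo order 2.
\<close>

lemma aut_comm_lead:
  assumes \<phi>: "aug_aut \<phi>" and \<psi>: "aug_aut \<psi>"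
    and X: "\<And>l. \<phi> (\<psi> (mps_X l)) - \<psi> (\<phi> (mps_X l)) \<in> adic (Suc e)"
    and y: "aut_inv \<phi> (aut_inv \<psi> f) - y \<in> adic 2"
  shows "aut_comm \<phi> \<psi> f - f - (\<phi> (\<psi> y) - \<psi> (\<phi> y)) \<in> adic (e + 2)"
proof -
  let ?z = "aut_inv \<phi> (aut_inv \<psi> f)"
  have hom: "aug_hom (\<phi> \<circ> \<psi>)" "aug_hom (\<psi> \<circ> \<phi>)"
    by (intro aug_aut_hom aug_aut_comp \<phi> \<psi>)+
  have "(\<phi> \<circ> \<psi>) (?z - y) - (\<psi> \<circ> \<phi>) (?z - y) \<in> adic (2 + e)"
    by (rule aug_hom_diff_adic(2)[OF hom _ y]) (simp add: X)
  then show ?thesis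
    unfolding aut_comm_minus_id[OF \<phi> \<psi> refl] aug_hom_diff[OF hom(1)] aug_hom_diff[OF hom(2)]
    by (simp add: algebra_simps)
qed

lemma aut_comm_comp_left:
  assumes \<phi>: "aug_aut \<phi>" and \<psi>: "aug_aut \<psi>" and \<theta>: "aug_aut \<theta>"
  shows "aut_comm (\<phi> \<circ> \<psi>) \<theta> = \<phi> \<circ> aut_comm \<psi> \<theta> \<circ> aut_inv \<phi> \<circ> aut_comm \<phi> \<theta>"
proof -
  have "aut_inv (\<phi> \<circ> \<psi>) = aut_inv \<psi> \<circ> aut_inv \<phi>"
    using \<phi> \<psi> by (intro o_inv_distrib) (simp_all add: aug_aut_def)
  then show ?thesis
    by (simp add: fun_eq_iff aut_comm_def aug_aut_inv_left \<phi> \<psi> \<theta>)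
qed

lemma aut_comm_comp_right:
  assumes \<phi>: "aug_aut \<phi>" and \<psi>: "aug_aut \<psi>" and \<theta>: "aug_aut \<theta>"
  shows "aut_comm \<phi> (\<psi> \<circ> \<theta>) = aut_comm \<phi> \<psi> \<circ> (\<psi> \<circ> aut_comm \<phi> \<theta> \<circ> aut_inv \<psi>)"
proof -
  have "aut_inv (\<psi> \<circ> \<theta>) = aut_inv \<theta> \<circ> aut_inv \<psi>"
    using \<theta> \<psi> by (intro o_inv_distrib) (simp_all add: aug_aut_def)
  then show ?thesis
    by (simp add: fun_eq_iff aut_comm_def aug_aut_inv_left \<phi> \<psi> \<theta>)
qed

text \<open>
  To leading order \<open>elem_aut i \<alpha> c - id\<close> acts as the derivation \<open>c X\<^sup>\<alpha> \<partial>\<^sub>i\<close>: it satisfies the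
  Leibniz rule up to the product of the two increments, which has higher order.
  If \<open>i\<close> does not occur in \<open>\<beta>\<close>, the truncated subtraction of \<open>{#i#}\<close> is harmless because the
  coefficient is 0.
\<close>

lemma elem_aut_term:
  assumes \<alpha>: "size \<alpha> = Suc s" and s: "s \<ge> 1"
  shows "elem_aut i \<alpha> c (mps_term b \<beta>) - mps_term b \<beta>
           - mps_term (of_nat (count \<beta> i) * c * b) (\<beta> - {#i#} + \<alpha>) \<in> adic (Suc (size \<beta> + s))"
proof -
  let ?E = "elem_aut i \<alpha> c"
  have dE: "depth_ge s ?E" by (rule depth_ge_elem[OF \<alpha> s])
  note hom = depth_ge_hom[OF dE]
  have "?E (mps_term 1 \<beta>) - mps_term 1 \<beta> - mps_term (of_nat (count \<beta> i) * c) (\<beta> - {#i#} + \<alpha>)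
      \<in> adic (Suc (size \<beta> + s))"
  proof (induction \<beta>)
    case empty
    then show ?case
      using aug_hom_const[OF hom, of 1] by (simp add: mps_const_eq_term)
  next
    case (add x \<beta>)
    let ?A = "\<lambda>f. ?E f - f" and ?X = "mps_X x" and ?m = "mps_term 1 \<beta>"
    let ?t = "mps_term (of_nat (count \<beta> i) * c) (\<beta> - {#i#} + \<alpha>)"
    let ?u = "if x = i then mps_term c \<alpha> else 0"
    have split: "mps_term 1 (add_mset x \<beta>) = ?X * ?m"
      by (simp add: mps_X_eq_term mps_term_mult)
    have AX: "?A ?X = ?u" using \<alpha> by (simp add: elem_aut_X)
    have "?X * ?t = mps_term (of_nat (count \<beta> i) * c) (add_mset x \<beta> - {#i#} + \<alpha>)"
    proof (cases "i \<in># \<beta>")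
      case True
      then have eq: "add_mset x (\<beta> - {#i#}) = add_mset x \<beta> - {#i#}" by (cases "x = i") auto
      have "?X * ?t = mps_term (of_nat (count \<beta> i) * c) (add_mset x (\<beta> - {#i#}) + \<alpha>)"
        by (simp add: mps_X_eq_term mps_term_mult)
      then show ?thesis unfolding eq .
    qed (simp add: not_in_iff)
    moreover have "?u * ?m = mps_term (if x = i then c else 0) (add_mset x \<beta> - {#i#} + \<alpha>)"
      by (simp add: mps_term_mult add.commute)
    ultimately have main: "?u * ?m + ?X * ?t
        = mps_term (of_nat (count (add_mset x \<beta>) i) * c) (add_mset x \<beta> - {#i#} + \<alpha>)"
      by (auto simp: mps_term_add[symmetric] algebra_simps)
    have "?A (?X * ?m) = ?A ?X * ?m + ?X * ?A ?m + ?A ?X * ?A ?m"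
      by (simp add: aug_hom_mult[OF hom] algebra_simps)
    then have eq: "?A (?X * ?m) - (?u * ?m + ?X * ?t) = ?X * (?A ?m - ?t) + ?u * ?A ?m"
      unfolding AX by (simp add: algebra_simps)
    have "?u \<in> adic (Suc s)" using \<alpha> by (simp add: mps_term_adic)
    moreover have "?A ?m \<in> adic (size \<beta> + s)"
      by (rule depth_ge_shift(2)[OF dE]) (simp add: mps_term_adic)
    ultimately have "?u * ?A ?m \<in> adic (Suc s + (size \<beta> + s))" by (rule adic_mult)
    then have "?u * ?A ?m \<in> adic (Suc (size (add_mset x \<beta>) + s))"
      by (rule adic_mono) (use s in simp)
    moreover have "?X * (?A ?m - ?t) \<in> adic (Suc (size (add_mset x \<beta>) + s))"
      using adic_mult[OF mps_X_adic[of x] add.IH] by simp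
    ultimately have "?A (?X * ?m) - (?u * ?m + ?X * ?t) \<in> adic (Suc (size (add_mset x \<beta>) + s))"
      unfolding eq by (intro adic_add)
    then show ?case
      unfolding split main by simp
  qed
  then have "mps_const b * (?E (mps_term 1 \<beta>) - mps_term 1 \<beta>
      - mps_term (of_nat (count \<beta> i) * c) (\<beta> - {#i#} + \<alpha>)) \<in> adic (Suc (size \<beta> + s))"
    by (rule adic_mult_left)
  moreover have "mps_const b * ?E (mps_term 1 \<beta>) = ?E (mps_term b \<beta>)"
    using aug_hom_mult[OF hom, of "mps_const b" "mps_term 1 \<beta>"]
    by (simp add: aug_hom_const[OF hom] const_mult_term)
  ultimately show ?thesis
    by (simp add: right_diff_distrib const_mult_term mult_ac)
qed

text \<open>
  The Lie bracket of \<open>X\<^sub>i\<^sup>s\<^sup>+\<^sup>1 \<partial>\<^sub>i\<close> and \<open>c X\<^sup>\<beta> \<partial>\<^sub>j\<close> is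
  \<open>(\<beta>\<^sub>i - \<delta>\<^sub>i\<^sub>j (s + 1)) c X\<^sub>i\<^sup>s X\<^sup>\<beta> \<partial>\<^sub>j\<close>.
\<close>

lemma aut_comm_elem:
  fixes i j :: "'n::finite" and c :: "'a::comm_ring_1" and \<sigma> :: "('a, 'n) mps \<Rightarrow> ('a, 'n) mps"
  assumes s: "s \<ge> 1" and \<beta>: "size \<beta> = Suc e" and e: "e \<ge> 1"
  defines "\<sigma> \<equiv> elem_aut i (replicate_mset (Suc s) i) 1"
  shows "aut_comm \<sigma> (elem_aut j \<beta> c) (mps_X l) - mps_X l
      - (if l = j then mps_term ((of_nat (count \<beta> i) - (if i = j then of_nat (Suc s) else 0)) * c)
            (\<beta> + replicate_mset s i) else 0) \<in> adic (s + e + 2)" (is "?P l")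
    and "depth_ge (s + e) (aut_comm \<sigma> (elem_aut j \<beta> c))"
proof -
  let ?\<alpha> = "replicate_mset (Suc s) i" and ?g = "elem_aut j \<beta> c"
  let ?t = "\<lambda>l. if l = j then mps_term ((of_nat (count \<beta> i) - (if i = j then of_nat (Suc s) else 0)) * c)
            (\<beta> + replicate_mset s i) else 0"
  have d\<sigma>: "depth_ge s \<sigma>" unfolding \<sigma>_def by (rule depth_ge_elem) (use s in simp_all)
  have dg: "depth_ge e ?g" by (rule depth_ge_elem[OF \<beta> e])
  note hom\<sigma> = depth_ge_hom[OF d\<sigma>] and homg = depth_ge_hom[OF dg]
  have \<sigma>X: "\<sigma> (mps_X l) = mps_X l + (if l = i then mps_term 1 ?\<alpha> else 0)" for l
    unfolding \<sigma>_def by (rule elem_aut_X) simp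
  have gX: "?g (mps_X l) = mps_X l + (if l = j then mps_term c \<beta> else 0)" for l
    by (rule elem_aut_X) (use \<beta> in simp)
  have lead: "\<sigma> (?g (mps_X l)) - ?g (\<sigma> (mps_X l)) - ?t l \<in> adic (s + e + 2)" for l
  proof -
    let ?a = "mps_term (of_nat (count \<beta> i) * 1 * c) (\<beta> - {#i#} + ?\<alpha>)"
    let ?b = "mps_term (of_nat (count ?\<alpha> j) * c * 1) (?\<alpha> - {#j#} + \<beta>)"
    let ?A = "\<sigma> (mps_term c \<beta>) - mps_term c \<beta> - ?a"
    let ?B = "?g (mps_term 1 ?\<alpha>) - mps_term 1 ?\<alpha> - ?b"
    have A: "?A \<in> adic (s + e + 2)"
      using elem_aut_term[of ?\<alpha> s i 1 c \<beta>] s \<beta> by (simp add: \<sigma>_def algebra_simps)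
    have B: "?B \<in> adic (s + e + 2)"
      using elem_aut_term[OF \<beta> e, of j c 1 ?\<alpha>] by (simp add: algebra_simps)
    have a: "?a = mps_term (of_nat (count \<beta> i) * c) (\<beta> + replicate_mset s i)"
    proof (cases "i \<in># \<beta>")
      case True
      then obtain \<gamma> where "\<beta> = add_mset i \<gamma>" by (metis multi_member_split)
      then show ?thesis by simp
    qed (simp add: not_in_iff)
    have b: "?b = (if i = j then mps_term (of_nat (Suc s) * c) (\<beta> + replicate_mset s i) else 0)"
      by (auto simp: add.commute)
    have "(if l = j then ?a else 0) - (if l = i then ?b else 0) = ?t l"
      unfolding a b by (auto simp: left_diff_distrib mps_term_diff)
    moreover have "\<sigma> (?g (mps_X l)) - ?g (\<sigma> (mps_X l))
        = (if l = j then ?A + ?a else 0) - (if l = i then ?B + ?b else 0)"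
      by (simp add: \<sigma>X gX aug_hom_add[OF hom\<sigma>] aug_hom_add[OF homg]
          aug_hom_zero[OF hom\<sigma>] aug_hom_zero[OF homg])
    ultimately have "\<sigma> (?g (mps_X l)) - ?g (\<sigma> (mps_X l)) - ?t l
        = (if l = j then ?A else 0) - (if l = i then ?B else 0)"
      by (simp add: algebra_simps split: if_splits)
    also have "\<dots> \<in> adic (s + e + 2)"
      using A B by (intro adic_diff) auto
    finally show ?thesis .
  qed
  have t: "?t l \<in> adic (Suc (s + e))" for l
    using \<beta> by (auto intro!: mps_term_adic)
  have swap: "\<sigma> (?g (mps_X l)) - ?g (\<sigma> (mps_X l)) \<in> adic (Suc (s + e))" for l
    using adic_add[OF adic_mono[OF lead[of l], of "Suc (s + e)"] t[of l]] by simp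
  have "depth_ge 1 (aut_inv \<sigma> \<circ> aut_inv ?g)"
    by (intro depth_ge_comp depth_ge_inv depth_ge_mono[OF d\<sigma>] depth_ge_mono[OF dg] s e)
  then have y: "aut_inv \<sigma> (aut_inv ?g (mps_X l)) - mps_X l \<in> adic 2" for l
    by (simp add: depth_ge_def numeral_2_eq_2)
  show main: "?P l" for l
    by (rule adic_diff_trans[OF aut_comm_lead[OF depth_ge_aut[OF d\<sigma>] depth_ge_aut[OF dg] swap y] lead])
  show "depth_ge (s + e) (aut_comm \<sigma> ?g)"
  proof (rule depth_geI)
    show "aug_aut (aut_comm \<sigma> ?g)"
      by (intro aug_aut_comm depth_ge_aut[OF d\<sigma>] depth_ge_aut[OF dg])
    show "aut_comm \<sigma> ?g (mps_X l) - mps_X l \<in> adic (Suc (s + e))" for l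
      using adic_add[OF adic_mono[OF main[of l], of "Suc (s + e)"] t[of l]] by simp
  qed
qed

text \<open>
  A diagonal linear map acts on \<open>X\<^sup>\<beta> \<partial>\<^sub>j\<close> by a scalar: substituting into \<open>X\<^sup>\<beta>\<close>
  contributes \<open>u ^ count \<beta> i\<close>, and the inverse map contributes \<open>v\<close> if it moves \<open>X\<^sub>j\<close>.
\<close>

lemma aut_comm_scale:
  fixes \<beta> :: "'n::finite multiset" and c u v :: "'a::comm_ring_1"
  assumes uv: "u * v = 1" and \<beta>: "size \<beta> = Suc e" and e: "e \<ge> 1"
  shows "aut_comm (scale_var i u) (elem_aut j \<beta> c) (mps_X l) - mps_X l
      - (if l = j then mps_term ((u ^ count \<beta> i * (if i = j then v else 1) - 1) * c) \<beta> else 0)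
      \<in> adic (e + 2)"
proof -
  let ?D = "scale_var i u" and ?g = "elem_aut j \<beta> c"
  let ?u = "\<lambda>l. if l = i then u else 1" and ?v = "\<lambda>l. if l = i then v else 1"
  have dg: "depth_ge e ?g" by (rule depth_ge_elem[OF \<beta> e])
  note homg = depth_ge_hom[OF dg] and D = aug_aut_scale_var[OF uv, of i]
  note homD = aug_aut_hom[OF D(1)]
  have gX: "?g (mps_X l) = mps_X l + (if l = j then mps_term c \<beta> else 0)" for l
    by (rule elem_aut_X) (use \<beta> in simp)
  have cX: "mps_term d {#l#} = mps_const d * mps_X l" for d :: 'a and l :: 'n
    by (simp add: mps_X_eq_term const_mult_term)
  have DX: "?D (mps_X l) = mps_const (?u l) * mps_X l" for l
    by (simp add: scale_var_X cX)
  have swap: "?D (?g (mps_X l)) - ?g (?D (mps_X l))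
      = (if l = j then mps_term ((u ^ count \<beta> i - ?u j) * c) \<beta> else 0)" for l
    unfolding gX DX aug_hom_mult[OF homg] aug_hom_const[OF homg] aug_hom_add[OF homD]
    by (simp add: algebra_simps scale_var_term aug_hom_zero[OF homD] const_mult_term mps_term_diff)
  \<comment> \<open>The image of \<open>X\<^sub>l\<close> under the inverse of \<open>?D\<close>.\<close>
  let ?y = "mps_const (?v l) * mps_X l"
  have "aut_inv ?g (mps_X l) - mps_X l \<in> adic 2"
    using depth_ge_inv[OF depth_ge_mono[OF dg e]] by (simp add: depth_ge_def numeral_2_eq_2)
  then have "scale_var i v (aut_inv ?g (mps_X l) - mps_X l) \<in> adic 2"
    by (rule aug_hom_adic[OF aug_hom_scale_var])
  then have y: "aut_inv ?D (aut_inv ?g (mps_X l)) - ?y \<in> adic 2"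
    by (simp add: aug_hom_diff[OF aug_hom_scale_var] D(2) scale_var_X cX)
  have "?D (?g ?y) - ?g (?D ?y) = mps_const (?v l) * (?D (?g (mps_X l)) - ?g (?D (mps_X l)))"
    by (simp only: aug_hom_mult[OF homg] aug_hom_mult[OF homD] aug_hom_const[OF homg]
        aug_hom_const[OF homD] right_diff_distrib)
  also have "\<dots> = (if l = j then mps_term ((u ^ count \<beta> i * (if i = j then v else 1) - 1) * c) \<beta> else 0)"
    using uv by (auto simp: swap const_mult_term algebra_simps intro!: arg_cong[of _ _ "\<lambda>x. mps_term x \<beta>"])
  finally have "?D (?g ?y) - ?g (?D ?y)
    = (if l = j then mps_term ((u ^ count \<beta> i * (if i = j then v else 1) - 1) * c) \<beta> else 0)" .
  moreover have "aut_comm ?D ?g (mps_X l) - mps_X l - (?D (?g ?y) - ?g (?D ?y)) \<in> adic (e + 2)"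
    by (rule aut_comm_lead[OF D(1) depth_ge_aut[OF dg] _ y])
      (use \<beta> in \<open>simp add: swap mps_term_adic\<close>)
  ultimately show ?thesis by simp
qed

section \<open>Every homogeneous term is a leading term\<close>

lemma of_int_invertible:
  assumes "Factorial_Ring.prime p" and p0: "of_nat p = (0 :: 'a::comm_ring_1)" and "\<not> int p dvd z"
  shows "\<exists>w. of_int z * w = (1 :: 'a)"
proof -
  have "Factorial_Ring.prime (int p)" using assms(1) by simp
  then have "coprime (int p) z"
    using assms(3) prime_imp_coprime by blast
  then have "gcd z (int p) = 1"
    by (simp only: coprime_iff_gcd_eq_1 gcd.commute[of z])
  then obtain x y where "x * z + y * int p = 1"
    using bezout_int[of z "int p"] by auto
  then have "of_int (x * z + y * int p) = (1 :: 'a)" by simp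
  then have "of_int z * of_int x = (1 :: 'a)"
    by (simp add: p0 mult.commute)
  then show ?thesis by blast
qed

text \<open>
  Take the image of a primitive root modulo \<open>p\<close>. If two exponents are incongruent modulo \<open>p - 1\<close>, the
  difference of the powers is an integer prime to \<open>p\<close>, hence a unit in any ring with \<open>p = 0\<close>.
\<close>

lemma primitive_root_of_unity_mod_p:
  assumes p: "Factorial_Ring.prime p" and p0: "of_nat p = (0 :: 'a::comm_ring_1)"
  obtains u v :: "'a::comm_ring_1" where "u * v = 1" "u ^ (p - 1) = 1"
    "\<And>m n. \<not> [m = n] (mod (p - 1)) \<Longrightarrow> \<exists>w. (u ^ m - u ^ n) * w = 1"
proof -
  obtain g where g: "residue_primroot p g"
    using prime_primitive_root_exists[of p] prime_gt_1_nat[OF p] p by auto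
  have cop: "coprime p g" and ord: "ord p g = p - 1"
    using g by (auto simp: residue_primroot_def totient_prime[OF p])
  define u where "u = (of_nat g :: 'a)"
  have of_int: "of_int z = (0 :: 'a)" if "int p dvd z" for z
    using that by (auto simp: p0)
  have "[g ^ (p - 1) = 1] (mod p)"
    by (simp only: ord_divides ord dvd_refl)
  then have "int p dvd int (g ^ (p - 1)) - int 1"
    by (simp only: cong_int_iff[symmetric] cong_iff_dvd_diff)
  from of_int[OF this] have u1: "u ^ (p - 1) = 1"
    by (simp add: u_def)
  have "\<exists>w. (u ^ m - u ^ n) * w = 1" if "\<not> [m = n] (mod (p - 1))" for m n
  proof -
    have "\<not> [g ^ m = g ^ n] (mod p)"
      using order_divides_expdiff[OF cop] ord that by simp
    then have "\<not> int p dvd int (g ^ m) - int (g ^ n)"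
      by (simp only: cong_int_iff[symmetric] cong_iff_dvd_diff not_False_eq_True)
    from of_int_invertible[OF p p0 this] show ?thesis
      by (simp add: u_def)
  qed
  moreover have "u * u ^ (p - 2) = 1"
    using u1 prime_gt_1_nat[OF p] by (simp flip: power_Suc add: Suc_diff_Suc numeral_2_eq_2)
  ultimately show ?thesis using that u1 by blast
qed

text \<open>The vector field \<open>r X\<^sup>\<alpha> \<partial>\<^sub>j\<close> is the leading term of \<open>\<phi>\<close>.\<close>

definition hits_term :: "nat \<Rightarrow> 'n::finite \<Rightarrow> 'n multiset \<Rightarrow> 'a::comm_ring_1 \<Rightarrow>
    (('a, 'n) mps \<Rightarrow> ('a, 'n) mps) \<Rightarrow> bool" where
  "hits_term d j \<alpha> r \<phi> \<longleftrightarrow> depth_ge d \<phi> \<and>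
     (\<forall>l. \<phi> (mps_X l) - mps_X l - (if l = j then mps_term r \<alpha> else 0) \<in> adic (d + 2))"

text \<open>Conjugation by the diagonal map fixes resonant terms.\<close>

lemma hits_term_scale_conj:
  fixes u v :: "'a::comm_ring_1"
  assumes uv: "u * v = 1" and \<phi>: "hits_term d j \<alpha> r \<phi>"
    and res: "u ^ count \<alpha> i = u ^ (if i = j then 1 else 0)"
  shows "hits_term d j \<alpha> r (scale_var i u \<circ> \<phi> \<circ> aut_inv (scale_var i u))"
  unfolding hits_term_def
proof (intro conjI allI)
  note D = aug_aut_scale_var[OF uv, of i]
  have d\<phi>: "depth_ge d \<phi>" using \<phi> by (simp add: hits_term_def)
  note hom = depth_ge_hom[OF d\<phi>]
  show "depth_ge d (scale_var i u \<circ> \<phi> \<circ> aut_inv (scale_var i u))"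
    by (rule depth_ge_conj[OF D(1) d\<phi>])
  fix l
  let ?v = "if l = i then v else 1" and ?u = "if l = i then u else 1"
  let ?t = "if l = j then mps_term r \<alpha> else 0"
  define \<rho> where "\<rho> = \<phi> (mps_X l) - mps_X l - ?t"
  have \<rho>: "\<rho> \<in> adic (d + 2)" using \<phi> by (simp add: hits_term_def \<rho>_def)
  have \<phi>X: "\<phi> (mps_X l) = mps_X l + ?t + \<rho>" by (simp add: \<rho>_def)
  have "mps_term ?v {#l#} = mps_const ?v * mps_X l"
    by (simp add: mps_X_eq_term const_mult_term)
  then have "aut_inv (scale_var i u) (mps_X l) = mps_const ?v * mps_X l"
    by (simp only: D(2) scale_var_X)
  then have "(scale_var i u \<circ> \<phi> \<circ> aut_inv (scale_var i u)) (mps_X l)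
      = mps_const ?v * scale_var i u (mps_X l + ?t + \<rho>)"
    by (simp only: comp_apply aug_hom_mult[OF hom] aug_hom_const[OF hom] \<phi>X
      aug_hom_mult[OF aug_hom_scale_var] aug_hom_const[OF aug_hom_scale_var])
  also have "\<dots> = mps_const ?v * scale_var i u (mps_X l) + mps_const ?v * scale_var i u ?t
      + mps_const ?v * scale_var i u \<rho>"
    by (simp only: aug_hom_add[OF aug_hom_scale_var] distrib_left)
  also have "mps_const ?v * scale_var i u (mps_X l) = mps_X l"
    unfolding scale_var_X const_mult_term using uv by (simp add: mult.commute mps_X_eq_term)
  also have "mps_const ?v * scale_var i u ?t = ?t"
  proof (cases "l = j")
    case True
    have "?v * u ^ count \<alpha> i = 1"
      using res uv True by (auto simp: mult.commute)
    then show ?thesis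
      unfolding if_P[OF True] scale_var_term const_mult_term
      by (simp only: mult.assoc[symmetric] mult_1)
  qed (simp add: aug_hom_zero[OF aug_hom_scale_var])
  finally show "(scale_var i u \<circ> \<phi> \<circ> aut_inv (scale_var i u)) (mps_X l) - mps_X l - ?t \<in> adic (d + 2)"
    using adic_mult_left[OF aug_hom_adic[OF aug_hom_scale_var \<rho>]] by simp
qed

lemma aut_comm_scale_id:
  fixes u v :: "'a::comm_ring_1"
  assumes uv: "u * v = 1" and \<beta>: "size \<beta> \<ge> 2"
    and res: "u ^ count \<beta> i = u ^ (if i = j then 1 else 0)"
  shows "aut_comm (scale_var i u) (elem_aut j \<beta> c) = id"
proof -
  let ?D = "scale_var i u" and ?g = "elem_aut j \<beta> c"
  note D = aug_aut_scale_var[OF uv, of i] and g = aug_aut_elem[OF \<beta>, of j c]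
  note hom = aug_hom_scale_var[of i u] and homg = aug_aut_hom[OF g]
  have gX: "?g (mps_X l) = mps_X l + (if l = j then mps_term c \<beta> else 0)" for l
    by (rule elem_aut_X) (use \<beta> in simp)
  have "?D \<circ> ?g = ?g \<circ> ?D"
  proof (rule aug_hom_eqI)
    fix l
    have DX: "?D (mps_X l) = mps_const (if l = i then u else 1) * mps_X l"
      unfolding scale_var_X by (simp add: mps_X_eq_term const_mult_term)
    show "(?D \<circ> ?g) (mps_X l) = (?g \<circ> ?D) (mps_X l)"
      unfolding comp_apply gX aug_hom_add[OF hom] DX aug_hom_mult[OF homg] aug_hom_const[OF homg]
      using res by (auto simp: distrib_left aug_hom_zero[OF hom] scale_var_term const_mult_term)
  qed (intro aug_hom_comp hom homg)+
  then have swap: "?D (?g f) = ?g (?D f)" for f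
    by (simp add: fun_eq_iff)
  have "aut_comm ?D ?g f - f = 0" for f
    unfolding aut_comm_minus_id[OF D(1) g refl] swap by simp
  then show ?thesis by (simp add: fun_eq_iff)
qed

text \<open>The substitutions \<open>\<sigma>\<^sub>i\<close> and \<open>\<tau>\<^sub>i\<close> of the introduction.\<close>

definition square_aut :: "'n::finite \<Rightarrow> ('a::comm_ring_1, 'n) mps \<Rightarrow> ('a, 'n) mps" where
  "square_aut i = elem_aut i (replicate_mset 2 i) 1"

definition twisted_power_aut :: "nat \<Rightarrow> 'a \<Rightarrow> 'n::finite \<Rightarrow> ('a::comm_ring_1, 'n) mps \<Rightarrow> ('a, 'n) mps" where
  "twisted_power_aut p u i = scale_var i u \<circ> elem_aut i (replicate_mset p i) 1"

text \<open>
  With \<open>\<tau> = D s\<close> one has \<open>[D s, x] = (D [s, x] D\<^sup>-\<^sup>1) [D, x]\<close>. The first factor is deeper than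
  \<open>x\<close>, so \<open>D\<close> alone determines the leading term, with a factor that is invertible by assumption.
\<close>

lemma aut_comm_hits_nonresonant:
  fixes u v :: "'a::comm_ring_1" and \<alpha> :: "'n::finite multiset"
  assumes uv: "u * v = 1" and p: "p \<ge> 2" and \<alpha>: "size \<alpha> = Suc d" and d: "d \<ge> 1"
    and w: "(u ^ count \<alpha> i - u ^ (if i = j then 1 else 0)) * w = 1"
  shows "\<exists>c. hits_term d j \<alpha> r (aut_comm (twisted_power_aut p u i) (elem_aut j \<alpha> c))"
proof -
  let ?u = "u ^ (if i = j then 1 else 0)" and ?v = "if i = j then v else 1"
  \<comment> \<open>The eigenvalue minus 1 is \<open>u ^ count \<alpha> i * ?v - 1\<close>; the factor \<open>?u\<close> clears \<open>?v\<close>.\<close>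
  define c where "c = r * w * ?u"
  have vu: "?v * ?u = 1" using uv by (auto simp: mult.commute)
  have "(u ^ count \<alpha> i * ?v - 1) * c = (u ^ count \<alpha> i * ?v - ?v * ?u) * c"
    by (simp only: vu)
  also have "\<dots> = r * ((u ^ count \<alpha> i - ?u) * w) * (?v * ?u)"
  proof -
    have "(x * y - y * z) * (r * w * z) = r * ((x - z) * w) * (y * z)" for x y z :: 'a
      by (simp add: algebra_simps)
    then show ?thesis unfolding c_def .
  qed
  also have "\<dots> = r" by (simp only: vu w mult_1_right)
  finally have cr: "(u ^ count \<alpha> i * ?v - 1) * c = r" .
  let ?D = "scale_var i u" and ?s = "elem_aut i (replicate_mset p i) (1 :: 'a)" and ?x = "elem_aut j \<alpha> c"
  have D: "aug_aut ?D" by (rule aug_aut_scale_var[OF uv])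
  have s: "aug_aut ?s" by (rule aug_aut_elem) (use p in simp)
  have dx: "depth_ge d ?x" by (rule depth_ge_elem[OF \<alpha> d])
  have "depth_ge (p - 1 + d) (aut_comm ?s ?x)"
    using aut_comm_elem(2)[of "p - 1" \<alpha> d i j c] p \<alpha> d by simp
  then have "depth_ge (Suc d) (aut_comm ?s ?x)"
    by (rule depth_ge_mono) (use p in simp)
  then have W: "depth_ge (Suc d) (?D \<circ> aut_comm ?s ?x \<circ> aut_inv ?D)"
    by (rule depth_ge_conj[OF D])
  have eq: "aut_comm (twisted_power_aut p u i) ?x
      = ?D \<circ> aut_comm ?s ?x \<circ> aut_inv ?D \<circ> aut_comm ?D ?x"
    unfolding twisted_power_aut_def by (rule aut_comm_comp_left[OF D s depth_ge_aut[OF dx]])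
  have "hits_term d j \<alpha> r (aut_comm (twisted_power_aut p u i) ?x)"
    unfolding hits_term_def
  proof (intro conjI allI)
    show "depth_ge d (aut_comm (twisted_power_aut p u i) ?x)"
      unfolding twisted_power_aut_def by (intro depth_ge_comm aug_aut_comp D s dx)
    fix l
    let ?t = "if l = j then mps_term r \<alpha> else 0"
    have a: "aut_comm ?D ?x (mps_X l) - mps_X l - ?t \<in> adic (d + 2)"
      using aut_comm_scale[OF uv \<alpha> d, of i j c l] by (simp only: cr)
    have b: "(?D \<circ> aut_comm ?s ?x \<circ> aut_inv ?D) (aut_comm ?D ?x (mps_X l))
        - aut_comm ?D ?x (mps_X l) \<in> adic (d + 2)"
      using depth_ge_shift(1)[OF W] by simp
    show "aut_comm (twisted_power_aut p u i) ?x (mps_X l) - mps_X l - ?t \<in> adic (d + 2)"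
      unfolding eq comp_apply[of _ "aut_comm ?D ?x"] using adic_add[OF b a] by (simp add: algebra_simps)
  qed
  then show ?thesis ..
qed

lemma hits_term_aut_comm_elem:
  assumes s: "s \<ge> 1" and \<beta>: "size \<beta> = Suc e" and e: "e \<ge> 1"
    and w: "(of_nat (count \<beta> i) - (if i = j then of_nat (Suc s) else 0)) * w = 1"
  shows "hits_term (s + e) j (\<beta> + replicate_mset s i) r
      (aut_comm (elem_aut i (replicate_mset (Suc s) i) 1) (elem_aut j \<beta> (w * r)))"
proof -
  have "(of_nat (count \<beta> i) - (if i = j then of_nat (Suc s) else 0)) * (w * r) = r"
    using w by (simp only: mult.assoc[symmetric] mult_1)
  then show ?thesis
    unfolding hits_term_def
    using aut_comm_elem[OF s \<beta> e, of i j "w * r"] by (simp only: simp_thms)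
qed

text \<open>
  The resonance count of the introduction. The unipotent part of \<open>\<tau>\<^sub>i\<close> needs an \<open>x\<close> whose depth is
  smaller by \<open>p - 1\<close>; the bound \<open>d - p\<close> covers all cases.
\<close>

lemma every_term_hit:
  fixes u v r :: "'a::comm_ring_1" and \<alpha> :: "'n::finite multiset"
  assumes p: "Factorial_Ring.prime p" "p \<ge> 5" and p0: "of_nat p = (0 :: 'a)"
    and uv: "u * v = 1" and u1: "u ^ (p - 1) = 1"
    and unit: "\<And>m n. \<not> [m = n] (mod (p - 1)) \<Longrightarrow> \<exists>w. (u ^ m - u ^ n) * w = 1"
    and d: "d \<ge> 1" and \<alpha>: "size \<alpha> = Suc d"
  shows "\<exists>i x. depth_ge 1 x \<and> depth_ge (d - p) x \<and>
    (hits_term d j \<alpha> r (aut_comm (square_aut i) x) \<or> hits_term d j \<alpha> r (aut_comm (twisted_power_aut p u i) x))"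
proof (cases "\<exists>i. \<not> [count \<alpha> i = (if i = j then 1 else 0)] (mod (p - 1))")
  case True
  then obtain i where i: "\<not> [count \<alpha> i = (if i = j then 1 else 0)] (mod (p - 1))" by blast
  from unit[OF this] obtain w where w: "(u ^ count \<alpha> i - u ^ (if i = j then 1 else 0)) * w = 1" by blast
  obtain c where "hits_term d j \<alpha> r (aut_comm (twisted_power_aut p u i) (elem_aut j \<alpha> c))"
    using aut_comm_hits_nonresonant[OF uv _ \<alpha> d w, of p r] p(2) by auto
  moreover have dx: "depth_ge d (elem_aut j \<alpha> c)" by (rule depth_ge_elem[OF \<alpha> d])
  ultimately show ?thesis
    using depth_ge_mono[OF dx d] depth_ge_mono[OF dx, of "d - p"] by auto
next
  case False
  let ?\<delta> = "\<lambda>i. if i = j then 1 else 0 :: nat"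
  \<comment> \<open>Otherwise \<open>X\<^sup>\<alpha>\<close> would divide \<open>X\<^sub>j\<close>, but its degree is at least 2.\<close>
  have "\<exists>i. count \<alpha> i > ?\<delta> i"
  proof (rule ccontr)
    assume "\<nexists>i. count \<alpha> i > ?\<delta> i"
    then have le: "count \<alpha> i \<le> ?\<delta> i" for i
      by (simp only: not_ex not_less)
    have "count \<alpha> i \<le> count {#j#} i" for i
      using le[of i] by (cases "i = j") simp_all
    then have "size \<alpha> \<le> size {#j#}"
      by (intro size_mset_mono mset_subset_eqI)
    then show False using \<alpha> d by simp
  qed
  then obtain i where i: "count \<alpha> i > ?\<delta> i" by blast
  define \<delta> where "\<delta> = ?\<delta> i"
  have \<delta>: "\<delta> \<le> 1" "count \<alpha> i > \<delta>" using i by (simp_all add: \<delta>_def)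
  have "(p - 1) dvd count \<alpha> i - \<delta>"
    using False \<delta>(2) cong_altdef_nat[of \<delta> "count \<alpha> i" "p - 1"] by (simp add: \<delta>_def)
  then obtain k where "count \<alpha> i - \<delta> = (p - 1) * k" by blast
  then have count: "count \<alpha> i = \<delta> + (p - 1) * k" and k: "k \<ge> 1"
    using \<delta>(2) by (simp, cases k) simp_all
  have size: "count \<alpha> i \<le> size \<alpha>" by (simp add: count_le_size)
  have "p - 1 \<le> (p - 1) * k" using k by simp
  then have d3: "d \<ge> 3" using size count \<alpha> p(2) by linarith
  show ?thesis
  \<comment> \<open>The integer is the structure constant of the bracket of \<open>X\<^sub>i\<^sup>2 \<partial>\<^sub>i\<close> with \<open>X\<^sup>\<alpha> / X\<^sub>i \<partial>\<^sub>j\<close>.\<close>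
  proof (cases "int p dvd int (count \<alpha> i) - 1 - 2 * int \<delta>")
    case ndvd: False
    define \<beta> where "\<beta> = \<alpha> - {#i#}"
    have i\<alpha>: "i \<in># \<alpha>" using \<delta>(2) by (metis count_eq_zero_iff less_nat_zero_code)
    have \<beta>: "size \<beta> = Suc (d - 1)" using i\<alpha> \<alpha> d by (simp add: \<beta>_def size_Diff_singleton)
    obtain w where w: "of_int (int (count \<alpha> i) - 1 - 2 * int \<delta>) * w = (1 :: 'a)"
      using of_int_invertible[OF p(1) p0 ndvd] by blast
    have "count \<alpha> i = Suc (count \<beta> i)" using \<delta>(2) by (simp add: \<beta>_def)
    then have "(of_nat (count \<beta> i) - (if i = j then of_nat (Suc 1) else 0)) * w = 1"
      using w by (cases "i = j") (simp_all add: \<delta>_def)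
    from hits_term_aut_comm_elem[OF order_refl \<beta> _ this, of r]
    have "hits_term d j \<alpha> r (aut_comm (square_aut i) (elem_aut j \<beta> (w * r)))"
      using d3 i\<alpha> by (simp add: square_aut_def \<beta>_def numeral_2_eq_2)
    moreover have dx: "depth_ge (d - 1) (elem_aut j \<beta> (w * r))"
      by (rule depth_ge_elem[OF \<beta>]) (use d3 in simp)
    moreover have "1 \<le> d - 1" "d - p \<le> d - 1" using d3 p(2) by linarith+
    ultimately show ?thesis
      using depth_ge_mono[OF dx] by blast
  next
    case dvd: True
    define s where "s = p - 1"
    have ps: "p = Suc s" using p(2) by (simp add: s_def)
    have eq: "int (count \<alpha> i) - 1 - 2 * int \<delta> = int p * int k - int (k + 1 + \<delta>)"
      by (simp add: count ps algebra_simps)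
    from dvd_diff[OF dvd_triv_left[of "int p" "int k"] dvd[unfolded eq]]
    have pk: "int p dvd int (k + 1 + \<delta>)" by simp
    then have "p dvd k + 1 + \<delta>" by (simp only: int_dvd_int_iff)
    then have "p \<le> k + 1 + \<delta>" by (rule dvd_imp_le) simp
    \<comment> \<open>So there is room to divide \<open>X\<^sup>\<alpha>\<close> by \<open>X\<^sub>i\<^sup>p\<^sup>-\<^sup>1\<close> and still have degree at least 2.\<close>
    then have k3: "k \<ge> 3" using \<delta>(1) p(2) by linarith
    then obtain k' where k': "k = Suc k'" "k' \<ge> 2" by (cases k) auto
    define \<beta> where "\<beta> = \<alpha> - replicate_mset s i"
    have count': "count \<alpha> i = \<delta> + s * k' + s" by (simp add: count s_def k')
    then have sub: "replicate_mset s i \<subseteq># \<alpha>" by (simp add: count_le_replicate_mset_subset_eq[symmetric])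
    have \<beta>count: "count \<beta> i = \<delta> + s * k'" by (simp add: \<beta>_def count')
    have "s * 2 \<le> s * k'" using k'(2) by (rule mult_le_mono2)
    then have "s + 2 \<le> d" using size count' \<alpha> p(2) ps by linarith
    then have \<beta>: "size \<beta> = Suc (d - s)" and e: "d - s \<ge> 1" and sd: "s + (d - s) = d"
      using sub \<alpha> by (simp_all add: \<beta>_def size_Diff_submset)
    have s1: "s \<ge> 1" using p(2) ps by simp
    have "\<not> int p dvd int (count \<beta> i)"
    proof
      assume "int p dvd int (count \<beta> i)"
      moreover have "int (count \<beta> i) = int p * int k' - int (k + 1 + \<delta>) + int (2 + 2 * \<delta>)"
        by (simp add: \<beta>count ps k' algebra_simps)
      ultimately have "int p dvd int p * int k' - int (k + 1 + \<delta>) + int (2 + 2 * \<delta>)"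
        by (simp only:)
      moreover have "int p dvd int p * int k' - int (k + 1 + \<delta>)"
        by (rule dvd_diff[OF dvd_triv_left pk])
      ultimately have "int p dvd int (2 + 2 * \<delta>)"
        by (simp only: dvd_add_right_iff)
      then have "p \<le> 2 + 2 * \<delta>" by (simp only: int_dvd_int_iff) (rule dvd_imp_le, simp_all)
      then show False using \<delta>(1) p(2) by linarith
    qed
    from of_int_invertible[OF p(1) p0 this] obtain w where "of_nat (count \<beta> i) * w = (1 :: 'a)" by auto
    then have "(of_nat (count \<beta> i) - (if i = j then of_nat (Suc s) else 0)) * w = 1"
      using p0 by (cases "i = j") (simp_all add: ps)
    from hits_term_aut_comm_elem[OF s1 \<beta> e this, of r]
    have hit: "hits_term d j \<alpha> r (aut_comm (elem_aut i (replicate_mset p i) 1) (elem_aut j \<beta> (w * r)))"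
      using sub by (simp add: sd ps[symmetric] \<beta>_def del: replicate_mset_Suc)
    have pow: "u ^ (\<delta> + s * m) = u ^ (if i = j then 1 else 0)" for m
      using u1 by (simp add: \<delta>_def power_add power_mult s_def)
    have \<beta>2: "size \<beta> \<ge> 2" using \<beta> e by simp
    have "aut_comm (twisted_power_aut p u i) (elem_aut j \<beta> (w * r))
      = scale_var i u \<circ> aut_comm (elem_aut i (replicate_mset p i) 1) (elem_aut j \<beta> (w * r))
          \<circ> aut_inv (scale_var i u)"
      unfolding twisted_power_aut_def
      using aut_comm_comp_left[OF aug_aut_scale_var(1)[OF uv] aug_aut_elem aug_aut_elem[OF \<beta>2],
          of "replicate_mset p i" i i 1 j "w * r"] p(2)
        aut_comm_scale_id[OF uv \<beta>2, of i j "w * r"] pow[of k'] \<beta>count by simp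
    then have "hits_term d j \<alpha> r (aut_comm (twisted_power_aut p u i) (elem_aut j \<beta> (w * r)))"
      using hits_term_scale_conj[OF uv hit, of i] pow[of k] count by (simp add: s_def)
    moreover have dx: "depth_ge (d - s) (elem_aut j \<beta> (w * r))"
      by (rule depth_ge_elem[OF \<beta> e])
    moreover have "d - p \<le> d - s" using ps by linarith
    ultimately show ?thesis
      using depth_ge_mono[OF dx] e by blast
  qed
qed

section \<open>Limits of automorphisms\<close>

lemma adic_limit_pointwise:
  fixes \<phi> :: "nat \<Rightarrow> 'b \<Rightarrow> ('a::comm_ring_1, 'n) mps"
  assumes "\<And>N f. \<phi> (Suc N) f - \<phi> N f \<in> adic N"
  obtains \<psi> where "\<And>N f. \<psi> f - \<phi> N f \<in> adic N"
proof -
  have "\<exists>g. \<forall>N. g - \<phi> N f \<in> adic N" for f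
    by (rule adic_complete) (rule assms)
  then obtain \<psi> where "\<forall>f N. \<psi> f - \<phi> N f \<in> adic N" by metis
  then show ?thesis using that by blast
qed

text \<open>
  The inverses form a Cauchy sequence as well, and their limit inverts the limit. Working with maps
  instead of the images of the variables, the limit is constructed without substitution.
\<close>

lemma aug_aut_limit:
  fixes \<phi> :: "nat \<Rightarrow> ('a::comm_ring_1, 'n::finite) mps \<Rightarrow> ('a, 'n) mps"
  assumes aut: "\<And>N. aug_aut (\<phi> N)"
    and cauchy: "\<And>N f. \<phi> (Suc N) f - \<phi> N f \<in> adic N"
  obtains \<psi> where "aug_aut \<psi>" "\<And>N f. \<psi> f - \<phi> N f \<in> adic N"
proof -
  note hom = aug_aut_hom[OF aut]
  obtain \<psi> where \<psi>: "\<And>N f. \<psi> f - \<phi> N f \<in> adic N"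
    using adic_limit_pointwise[of \<phi>, OF cauchy] by blast
  have cauchy': "aut_inv (\<phi> (Suc N)) f - aut_inv (\<phi> N) f \<in> adic N" for N f
  proof -
    let ?y = "aut_inv (\<phi> N) f"
    have "\<phi> N ?y - \<phi> (Suc N) ?y \<in> adic N"
      using adic_uminus[OF cauchy[of N ?y]] by simp
    from aug_hom_adic[OF aug_aut_hom[OF aug_aut_inv[OF aut[of "Suc N"]]] this]
    show ?thesis
      by (simp add: aug_hom_diff[OF aug_aut_hom[OF aug_aut_inv[OF aut]]]
          aug_aut_inv_left[OF aut] aug_aut_inv_right[OF aut])
  qed
  obtain \<theta> where \<theta>: "\<And>N f. \<theta> f - aut_inv (\<phi> N) f \<in> adic N"
    using adic_limit_pointwise[of "\<lambda>N. aut_inv (\<phi> N)", OF cauchy'] by blast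
  have eqI: "f = g" if "\<And>N. f - g \<in> adic N" for f g :: "('a, 'n) mps"
    using adic_separated[of "f - g"] that by simp
  have "\<psi> (f + g) = \<psi> f + \<psi> g" for f g
  proof (rule eqI)
    fix N
    have "\<psi> (f + g) - \<phi> N (f + g) - ((\<psi> f - \<phi> N f) + (\<psi> g - \<phi> N g)) \<in> adic N"
      by (intro adic_diff adic_add \<psi>)
    then show "\<psi> (f + g) - (\<psi> f + \<psi> g) \<in> adic N"
      by (simp add: aug_hom_add[OF hom] algebra_simps)
  qed
  moreover have "\<psi> (f * g) = \<psi> f * \<psi> g" for f g
  proof (rule eqI)
    fix N
    have "\<psi> g * (\<psi> f - \<phi> N f) \<in> adic N" "\<phi> N f * (\<psi> g - \<phi> N g) \<in> adic N"
      by (intro adic_mult_left \<psi>)+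
    from adic_diff[OF \<psi>[of "f * g" N] adic_add[OF this]]
    show "\<psi> (f * g) - \<psi> f * \<psi> g \<in> adic N"
      by (simp add: aug_hom_mult[OF hom] algebra_simps)
  qed
  moreover have "\<psi> (mps_const c) = mps_const c" for c
    using \<psi>[of "mps_const c"] by (intro eqI) (simp add: aug_hom_const[OF hom])
  moreover have "\<psi> (mps_X i) \<in> adic (Suc 0)" for i
    using adic_add[OF \<psi>[of "mps_X i" "Suc 0"] aug_hom_X[OF hom[of "Suc 0"], of i]] by simp
  ultimately have hom\<psi>: "aug_hom \<psi>" by (simp add: aug_hom_def)
  have "\<psi> (\<theta> f) = f" for f
  proof (rule eqI)
    fix N
    have "\<phi> N (\<theta> f - aut_inv (\<phi> N) f) \<in> adic N"
      by (rule aug_hom_adic[OF hom \<theta>])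
    from adic_add[OF \<psi>[of "\<theta> f" N] this] show "\<psi> (\<theta> f) - f \<in> adic N"
      by (simp add: aug_hom_diff[OF hom] aug_aut_inv_right[OF aut])
  qed
  moreover have "\<theta> (\<psi> f) = f" for f
  proof (rule eqI)
    fix N
    have "aut_inv (\<phi> N) (\<psi> f - \<phi> N f) \<in> adic N"
      by (rule aug_hom_adic[OF aug_aut_hom[OF aug_aut_inv[OF aut]] \<psi>])
    from adic_add[OF \<theta>[of "\<psi> f" N] this] show "\<theta> (\<psi> f) - f \<in> adic N"
      by (simp add: aug_hom_diff[OF aug_aut_hom[OF aug_aut_inv[OF aut]]] aug_aut_inv_left[OF aut])
  qed
  ultimately have "bij \<psi>"
    by (intro o_bij[of \<theta>]) (simp_all add: fun_eq_iff)
  with hom\<psi> have "aug_aut \<psi>" by (simp add: aug_aut_def)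
  then show ?thesis using that \<psi> by blast
qed

section \<open>Solving for products of commutators\<close>

primrec comm_prod :: "(nat \<Rightarrow> 'b \<Rightarrow> 'b) \<Rightarrow> (nat \<Rightarrow> 'b \<Rightarrow> 'b) \<Rightarrow> nat \<Rightarrow> 'b \<Rightarrow> 'b" where
  "comm_prod a g 0 = id"
| "comm_prod a g (Suc k) = comm_prod a g k \<circ> aut_comm (a k) (g k)"

lemma comm_prod_cong: "(\<And>t. t < k \<Longrightarrow> g t = g' t) \<Longrightarrow> comm_prod a g k = comm_prod a g' k"
  by (induction k) auto

lemma aug_aut_comm_prod:
  "(\<And>t. aug_aut (a t)) \<Longrightarrow> (\<And>t. aug_aut (g t)) \<Longrightarrow> aug_aut (comm_prod a g k)"
  by (induction k) (auto intro: aug_aut_id aug_aut_comp aug_aut_comm)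

lemma depth_ge_comm_prod:
  "(\<And>t. aug_aut (a t)) \<Longrightarrow> (\<And>t. depth_ge d (g t)) \<Longrightarrow> depth_ge d (comm_prod a g k)"
  by (induction k) (auto intro: depth_ge_id depth_ge_comp depth_ge_comm)

lemma UN_pair_eq: "(\<Union>x\<in>A. \<Union>y\<in>B. {f x y}) = {f x y |x y. x \<in> A \<and> y \<in> B}"
  by blast

lemma derived_set_GA:
  fixes R :: "'a::comm_ring_1 itself" and N :: "'n::finite itself"
  shows "derived_set (GA R N) (carrier (GA R N)) = {aut_comm \<phi> \<psi> |\<phi> \<psi>. aug_aut \<phi> \<and> aug_aut \<psi>}"
proof -
  have comm: "\<phi> \<otimes>\<^bsub>GA R N\<^esub> \<psi> \<otimes>\<^bsub>GA R N\<^esub> inv\<^bsub>GA R N\<^esub> \<phi> \<otimes>\<^bsub>GA R N\<^esub> inv\<^bsub>GA R N\<^esub> \<psi> = aut_comm \<phi> \<psi>"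
    if "aug_aut \<phi>" "aug_aut \<psi>" for \<phi> \<psi> :: "('a, 'n) mps \<Rightarrow> ('a, 'n) mps"
    unfolding mult_GA inv_GA[OF that(1)] inv_GA[OF that(2)] aut_comm_def ..
  have carrier: "carrier (GA R N) = Collect aug_aut"
    by (auto simp: carrier_GA_iff)
  have "derived_set (GA R N) (carrier (GA R N))
      = (\<Union>\<phi>\<in>Collect aug_aut. \<Union>\<psi>\<in>Collect aug_aut. {aut_comm \<phi> \<psi>})"
    unfolding carrier by (intro SUP_cong refl) (simp only: comm mem_Collect_eq)
  then show ?thesis by (simp only: UN_pair_eq mem_Collect_eq)
qed

lemma commutator_products_Suc_GA:
  fixes R :: "'a::comm_ring_1 itself" and N :: "'n::finite itself"
  shows "commutator_products (GA R N) (Suc k)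
    = {\<theta> \<circ> aut_comm \<phi> \<psi> |\<theta> \<phi> \<psi>. \<theta> \<in> commutator_products (GA R N) k \<and> aug_aut \<phi> \<and> aug_aut \<psi>}"
proof -
  have "{f x y |x y. x \<in> A \<and> y \<in> {g u v |u v. P u v}} = {f x (g u v) |x u v. x \<in> A \<and> P u v}"
    for f :: "'b \<Rightarrow> 'c \<Rightarrow> 'd" and g :: "'e \<Rightarrow> 'e \<Rightarrow> 'c" and A P
    by blast
  note regroup = this
  show ?thesis
    unfolding commutator_products.simps derived_set_GA
    unfolding set_mult_def mult_GA UN_pair_eq by (rule regroup)
qed

lemma comm_prod_in:
  fixes R :: "'a::comm_ring_1 itself" and N :: "'n::finite itself"
  assumes "\<And>t. aug_aut (a t)" and "\<And>t. aug_aut (g t)"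
  shows "comm_prod a g k \<in> commutator_products (GA R N) k"
proof (induction k)
  case (Suc k)
  then show ?case
    unfolding commutator_products_Suc_GA comm_prod.simps using assms by blast
qed (simp add: one_GA id_def)

lemma aut_comm_approx:
  assumes a: "aug_aut a" and g: "aug_aut g" "aug_aut g'"
    and near: "\<And>f. g' f - g f \<in> adic N"
  shows "aut_comm a g' f - aut_comm a g f \<in> adic N"
proof -
  note homa = aug_aut_hom[OF a] and homg = aug_aut_hom[OF g(1)]
  let ?y = "aut_inv g f" and ?y' = "aut_inv g' f"
  have "g ?y' - g' ?y' \<in> adic N"
    using adic_uminus[OF near[of ?y']] by simp
  from aug_hom_adic[OF aug_aut_hom[OF aug_aut_inv[OF g(1)]] this]
  have y: "?y' - ?y \<in> adic N"
    by (simp add: aug_hom_diff[OF aug_aut_hom[OF aug_aut_inv[OF g(1)]]]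
        aug_aut_inv_left[OF g(1)] aug_aut_inv_right[OF g(2)])
  let ?z = "aut_inv a ?y" and ?z' = "aut_inv a ?y'"
  have "?z' - ?z \<in> adic N"
    using aug_hom_adic[OF aug_aut_hom[OF aug_aut_inv[OF a]] y]
    by (simp add: aug_hom_diff[OF aug_aut_hom[OF aug_aut_inv[OF a]]])
  from aug_hom_adic[OF homg this] have "g ?z' - g ?z \<in> adic N"
    by (simp add: aug_hom_diff[OF homg])
  from adic_diff_trans[OF near[of ?z'] this] have "g' ?z' - g ?z \<in> adic N" .
  from aug_hom_adic[OF homa this] show ?thesis
    by (simp add: aug_hom_diff[OF homa] aut_comm_def)
qed

lemma comm_prod_approx:
  assumes a: "\<And>t. aug_aut (a t)" and g: "\<And>t. aug_aut (g t)" "\<And>t. aug_aut (g' t)"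
    and near: "\<And>t f. g' t f - g t f \<in> adic N"
  shows "comm_prod a g' k f - comm_prod a g k f \<in> adic N"
proof (induction k arbitrary: f)
  case (Suc k)
  let ?P = "comm_prod a g k" and ?y = "aut_comm (a k) (g k) f" and ?y' = "aut_comm (a k) (g' k) f"
  have hom: "aug_hom ?P" by (intro aug_aut_hom aug_aut_comm_prod a g)
  have "?y' - ?y \<in> adic N"
    by (rule aut_comm_approx[OF a g near])
  from aug_hom_adic[OF hom this] have "?P ?y' - ?P ?y \<in> adic N"
    by (simp add: aug_hom_diff[OF hom])
  from adic_diff_trans[OF Suc[of ?y'] this] show ?case by simp
qed simp

text \<open>
  The key step: multiplying one \<open>g t\<close> by \<open>x\<close> inserts a conjugate of \<open>[a t, x]\<close> into the product, by
  elements of depth 1 only, so that to leading order \<open>[a t, x]\<close> is simply added.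
\<close>

lemma comm_prod_update:
  assumes a: "\<And>t. aug_aut (a t)" and g: "\<And>t. depth_ge 1 (g t)"
    and x: "depth_ge 1 x" and c: "depth_ge d (aut_comm (a t) x)" and t: "t < k"
  shows "comm_prod a (g(t := g t \<circ> x)) k (mps_X l) - comm_prod a g k (mps_X l)
      - (aut_comm (a t) x (mps_X l) - mps_X l) \<in> adic (d + 2)"
  using t
proof (induction k arbitrary: l)
  case (Suc k)
  define g' where "g' = g(t := g t \<circ> x)"
  let ?c = "aut_comm (a t) x"
  let ?Q = "comm_prod a g k" and ?Q' = "comm_prod a g' k"
  have g'_t: "g' t = g t \<circ> x" and g'_other: "\<And>s. s \<noteq> t \<Longrightarrow> g' s = g s"
    by (simp_all add: g'_def)
  have g': "depth_ge 1 (g' s)" for s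
    using depth_ge_comp[OF g x] g g'_t g'_other by (cases "s = t") simp_all
  note IH = Suc.IH[folded g'_def]
  have dQ: "depth_ge 1 ?Q" and dQ': "depth_ge 1 ?Q'"
    by (intro depth_ge_comm_prod a g g')+
  show ?case
  proof (cases "t = k")
    case True
    let ?w = "g t" and ?U = "?Q \<circ> aut_comm (a t) (g t)"
    let ?y = "aut_inv ?w (mps_X l)"
    \<comment> \<open>The product changes from \<open>W (w\<^sup>-\<^sup>1 X\<^sub>l)\<close> to \<open>W (c (w\<^sup>-\<^sup>1 X\<^sub>l))\<close> with \<open>W\<close> and \<open>w\<close> of depth 1.\<close>
    have dw: "depth_ge 1 ?w" by (rule g)
    have dU: "depth_ge 1 (?U \<circ> ?w)" by (intro depth_ge_comp dQ depth_ge_comm a g)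
    have QQ: "?Q' = ?Q" using True by (intro comm_prod_cong g'_other) simp
    have new: "comm_prod a g' (Suc k) (mps_X l) = (?U \<circ> ?w) (?c ?y)"
      using True QQ g'_t aut_comm_comp_right[OF a[of t] depth_ge_aut[OF dw] depth_ge_aut[OF x]] by simp
    have old: "comm_prod a g (Suc k) (mps_X l) = (?U \<circ> ?w) ?y"
      using True by (simp add: aug_aut_inv_right[OF depth_ge_aut[OF g]])
    have "?y - mps_X l \<in> adic 2"
      using depth_ge_inv[OF dw] by (simp add: depth_ge_def numeral_2_eq_2)
    from depth_ge_shift(2)[OF c this]
    have 1: "(?c ?y - ?y) - (?c (mps_X l) - mps_X l) \<in> adic (d + 2)"
      by (simp add: aug_hom_diff[OF depth_ge_hom[OF c]] algebra_simps)
    have "?c ?y - ?y \<in> adic (Suc d)" by (rule depth_ge_shift(1)[OF c])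
    from depth_ge_shift(2)[OF dU this]
    have 2: "(?U \<circ> ?w) (?c ?y - ?y) - (?c ?y - ?y) \<in> adic (d + 2)" by simp
    show ?thesis
      using adic_diff_trans[OF 2 1]
      unfolding g'_def[symmetric] new old aug_hom_diff[OF depth_ge_hom[OF dU]] .
  next
    case False
    then have tk: "t < k" using Suc.prems by simp
    let ?b = "aut_comm (a k) (g k)"
    \<comment> \<open>The last commutator moves \<open>X\<^sub>l\<close> by terms of order at least 2, on which the change of the other
      factors is negligible.\<close>
    have b: "?b (mps_X l) - mps_X l \<in> adic 2"
      using depth_ge_comm[OF a[of k] g[of k]] by (simp add: depth_ge_def numeral_2_eq_2)
    have "?Q' (mps_X i) - ?Q (mps_X i) \<in> adic (Suc d)" for i
      using adic_add[OF adic_mono[OF IH[OF tk, of i], of "Suc d"] depth_ge_shift(1)[OF c, of "mps_X i"]]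
      by simp
    from aug_hom_diff_adic(2)[OF depth_ge_hom[OF dQ'] depth_ge_hom[OF dQ] this b]
    have "?Q' (?b (mps_X l)) - ?Q (?b (mps_X l)) - (?Q' (mps_X l) - ?Q (mps_X l)) \<in> adic (d + 2)"
      by (simp add: aug_hom_diff[OF depth_ge_hom[OF dQ]] aug_hom_diff[OF depth_ge_hom[OF dQ']] algebra_simps)
    from adic_diff_trans[OF this IH[OF tk]] show ?thesis
      unfolding g'_def[symmetric] using False g'_other[of k] by simp
  qed
qed simp

text \<open>
  All homogeneous vector fields of degree at least 2 are leading terms of commutators with one of the
  first \<open>k\<close> entries of \<open>a\<close>. The bound \<open>d - s\<close> makes the successive approximation converge, and
  depth 1 keeps it inside the automorphisms with identity linear part.
\<close>

definition hits_all_terms :: "(nat \<Rightarrow> ('a::comm_ring_1, 'n::finite) mps \<Rightarrow> ('a, 'n) mps) \<Rightarrow>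
    nat \<Rightarrow> nat \<Rightarrow> bool" where
  "hits_all_terms a k s \<longleftrightarrow> (\<forall>d j \<alpha> r. d \<ge> 1 \<longrightarrow> size \<alpha> = Suc d \<longrightarrow>
     (\<exists>t<k. \<exists>x. depth_ge 1 x \<and> depth_ge (d - s) x \<and> hits_term d j \<alpha> r (aut_comm (a t) x)))"

lemma comm_prod_add_terms:
  fixes a g :: "nat \<Rightarrow> ('a::comm_ring_1, 'n::finite) mps \<Rightarrow> ('a, 'n) mps"
  assumes a: "\<And>t. aug_aut (a t)" and hits: "hits_all_terms a k s" and d: "d \<ge> 1"
    and g: "\<And>t. depth_ge 1 (g t)"
    and F: "finite F" "\<forall>q\<in>F. size (snd q) = Suc d"
  shows "\<exists>g'. (\<forall>t. depth_ge 1 (g' t)) \<and> (\<forall>t f. g' t f - g t f \<in> adic (d - s)) \<and>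
    (\<forall>l. comm_prod a g' k (mps_X l) - comm_prod a g k (mps_X l)
        - (\<Sum>q\<in>F. if l = fst q then mps_term (r q) (snd q) else 0) \<in> adic (d + 2))"
  using F
proof (induction F)
  case empty
  show ?case using g by (intro exI[of _ g]) simp
next
  case (insert q F)
  obtain j \<alpha> where q: "q = (j, \<alpha>)" by (cases q)
  have "\<forall>q\<in>F. size (snd q) = Suc d"
    using insert.prems by simp
  from insert.IH[OF this] obtain g' where
    *: "(\<forall>t. depth_ge 1 (g' t)) \<and> (\<forall>t f. g' t f - g t f \<in> adic (d - s)) \<and>
    (\<forall>l. comm_prod a g' k (mps_X l) - comm_prod a g k (mps_X l)
        - (\<Sum>q\<in>F. if l = fst q then mps_term (r q) (snd q) else 0) \<in> adic (d + 2))"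
    by (elim exE)
  note g' = *[THEN conjunct1, rule_format] *[THEN conjunct2, THEN conjunct1, rule_format]
    and P' = *[THEN conjunct2, THEN conjunct2, rule_format]
  have "size \<alpha> = Suc d" using insert.prems by (simp add: q)
  then obtain t x where t: "t < k" and x: "depth_ge 1 x" "depth_ge (d - s) x"
    and hit: "hits_term d j \<alpha> (r q) (aut_comm (a t) x)"
    using hits[unfolded hits_all_terms_def, rule_format, OF d] by blast
  let ?g = "g'(t := g' t \<circ> x)"
  have "depth_ge 1 (?g u)" for u
    using depth_ge_comp[OF g'(1)[of t] x(1)] g'(1)[of u] by (cases "u = t") simp_all
  moreover have "?g u f - g u f \<in> adic (d - s)" for u f
  proof (cases "u = t")
    case True
    have "g' t (x f - f) \<in> adic (d - s)"
      using aug_hom_adic[OF depth_ge_hom[OF g'(1)] depth_ge_shift(2)[OF x(2) adic_0]] by simp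
    from adic_add[OF this g'(2)[of t f]] show ?thesis
      using True by (simp add: aug_hom_diff[OF depth_ge_hom[OF g'(1)]])
  qed (simp add: g')
  moreover have "comm_prod a ?g k (mps_X l) - comm_prod a g k (mps_X l)
      - (\<Sum>q\<in>insert q F. if l = fst q then mps_term (r q) (snd q) else 0) \<in> adic (d + 2)" for l
  proof -
    let ?C = "aut_comm (a t) x (mps_X l) - mps_X l" and ?u = "if l = fst q then mps_term (r q) (snd q) else 0"
    let ?S = "\<Sum>q\<in>F. if l = fst q then mps_term (r q) (snd q) else 0"
    have "depth_ge d (aut_comm (a t) x)" using hit by (simp add: hits_term_def)
    from comm_prod_update[of a g' x d t k l, OF a g'(1) x(1) this t]
    have 1: "comm_prod a ?g k (mps_X l) - comm_prod a g' k (mps_X l) - ?C \<in> adic (d + 2)" .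
    have "hits_term d (fst q) (snd q) (r q) (aut_comm (a t) x)"
      using hit by (simp only: q fst_conv snd_conv)
    then have 2: "?C - ?u \<in> adic (d + 2)"
      by (rule hits_term_def[THEN iffD1, THEN conjunct2, rule_format])
    have "comm_prod a ?g k (mps_X l) - comm_prod a g k (mps_X l) - (?u + ?S) \<in> adic (d + 2)"
      using adic_add[OF adic_diff_trans[OF 1 2] P'[of l]] by (simp add: algebra_simps)
    then show ?thesis unfolding sum.insert[OF insert.hyps] .
  qed
  ultimately show ?case by blast
qed

lemma comm_prod_improve:
  fixes a g :: "nat \<Rightarrow> ('a::comm_ring_1, 'n::finite) mps \<Rightarrow> ('a, 'n) mps"
  assumes a: "\<And>t. aug_aut (a t)" and hits: "hits_all_terms a k s" and d: "d \<ge> 1"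
    and g: "\<And>t. depth_ge 1 (g t)"
    and near: "\<And>l. h (mps_X l) - comm_prod a g k (mps_X l) \<in> adic (Suc d)"
  shows "\<exists>g'. (\<forall>t. depth_ge 1 (g' t)) \<and> (\<forall>t f. g' t f - g t f \<in> adic (d - s)) \<and>
    (\<forall>l. h (mps_X l) - comm_prod a g' k (mps_X l) \<in> adic (d + 2))"
proof -
  let ?e = "\<lambda>l. h (mps_X l) - comm_prod a g k (mps_X l)"
  let ?A = "{\<alpha> :: 'n multiset. size \<alpha> = Suc d}"
  define r where "r q = mps_coeff (?e (fst q)) (snd q)" for q
  have "finite (UNIV \<times> ?A :: ('n \<times> 'n multiset) set)" "\<forall>q\<in>UNIV \<times> ?A. size (snd q) = Suc d"
    by (auto simp: finite_size_eq)
  from comm_prod_add_terms[where r = r and a = a and g = g, OF a hits d g this] obtain g' where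
    *: "(\<forall>t. depth_ge 1 (g' t)) \<and> (\<forall>t f. g' t f - g t f \<in> adic (d - s)) \<and>
    (\<forall>l. comm_prod a g' k (mps_X l) - comm_prod a g k (mps_X l)
        - (\<Sum>q\<in>UNIV \<times> ?A. if l = fst q then mps_term (r q) (snd q) else 0) \<in> adic (d + 2))"
    by (elim exE)
  note P' = *[THEN conjunct2, THEN conjunct2, rule_format]
  have "h (mps_X l) - comm_prod a g' k (mps_X l) \<in> adic (d + 2)" for l
  proof -
    have "(\<Sum>q\<in>UNIV \<times> ?A. if l = fst q then mps_term (r q) (snd q) else 0)
        = (\<Sum>j\<in>UNIV. \<Sum>\<alpha>\<in>?A. if l = j then mps_term (r (j, \<alpha>)) \<alpha> else 0)"
      unfolding sum.cartesian_product by (intro sum.cong) auto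
    also have "\<dots> = (\<Sum>j\<in>UNIV. if l = j then \<Sum>\<alpha>\<in>?A. mps_term (r (j, \<alpha>)) \<alpha> else 0)"
      by (intro sum.cong) auto
    also have "\<dots> = (\<Sum>\<alpha>\<in>?A. mps_term (mps_coeff (?e l) \<alpha>) \<alpha>)"
      by (simp add: r_def)
    finally have "?e l - (\<Sum>q\<in>UNIV \<times> ?A. if l = fst q then mps_term (r q) (snd q) else 0) \<in> adic (d + 2)"
      using adic_minus_terms[OF near[of l]] by simp
    from adic_diff[OF this P'[of l]] show ?thesis by simp
  qed
  with * show ?thesis by (intro exI[of _ g']) simp
qed

text \<open>
  The factors that improve the agreement with \<open>h\<close> from order \<open>d + 2\<close> to order \<open>d + 3\<close> have depth at
  least \<open>d + 1 - s\<close>, so the sequence of approximate solutions, shifted by \<open>s\<close>, is a Cauchy sequence.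
\<close>

theorem comm_prod_surj:
  fixes a :: "nat \<Rightarrow> ('a::comm_ring_1, 'n::finite) mps \<Rightarrow> ('a, 'n) mps"
  assumes a: "\<And>t. aug_aut (a t)" and hits: "hits_all_terms a k s" and h: "depth_ge 1 h"
  shows "\<exists>g. (\<forall>t. aug_aut (g t)) \<and> h = comm_prod a g k"
proof -
  define good where "good d g \<longleftrightarrow> (\<forall>t. depth_ge 1 (g t)) \<and>
    (\<forall>l. h (mps_X l) - comm_prod a g k (mps_X l) \<in> adic (d + 2))" for d g
  have id: "aut_comm \<phi> id = id" if "aug_aut \<phi>" for \<phi> :: "('a, 'n) mps \<Rightarrow> ('a, 'n) mps"
    using that by (simp add: aut_comm_def fun_eq_iff aug_aut_inv_right)
  have P: "comm_prod a (\<lambda>_. id) k = id"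
  proof (induction k)
    case (Suc k)
    show ?case unfolding comm_prod.simps Suc id[OF a] by (rule comp_id)
  qed simp
  have good0: "good 0 (\<lambda>_. id)"
    unfolding good_def
  proof (intro conjI allI)
    show "depth_ge 1 (id :: ('a, 'n) mps \<Rightarrow> ('a, 'n) mps)" by (rule depth_ge_id)
    show "h (mps_X l) - comm_prod a (\<lambda>_. id) k (mps_X l) \<in> adic (0 + 2)" for l
      unfolding P using depth_ge_shift(1)[OF h, of "mps_X l"] by simp
  qed
  have improve: "\<exists>g'. good (Suc d) g' \<and> (\<forall>t f. g' t f - g t f \<in> adic (Suc d - s))" if "good d g" for g d
  proof -
    have "\<And>t. depth_ge 1 (g t)" "\<And>l. h (mps_X l) - comm_prod a g k (mps_X l) \<in> adic (Suc (Suc d))"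
      using that by (simp_all add: good_def)
    from comm_prod_improve[where h = h and a = a and g = g, OF a hits _ this] obtain g' where
      "(\<forall>t. depth_ge 1 (g' t)) \<and> (\<forall>t f. g' t f - g t f \<in> adic (Suc d - s)) \<and>
        (\<forall>l. h (mps_X l) - comm_prod a g' k (mps_X l) \<in> adic (Suc d + 2))"
      by auto
    then show ?thesis by (intro exI[of _ g']) (simp add: good_def)
  qed
  obtain G where G': "\<And>d. good d (G d)" and step: "\<And>d t f. G (Suc d) t f - G d t f \<in> adic (Suc d - s)"
    using dependent_nat_choice[of good "\<lambda>d g g'. \<forall>t f. g' t f - g t f \<in> adic (Suc d - s)",
        OF exI[of "good 0", OF good0] improve] by auto
  have G: "depth_ge 1 (G d t)" and P: "h (mps_X l) - comm_prod a (G d) k (mps_X l) \<in> adic (d + 2)" for d t l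
    using G'[of d] by (simp_all add: good_def)
  have "\<exists>\<psi>. aug_aut \<psi> \<and> (\<forall>N f. \<psi> f - G (N + s) t f \<in> adic N)" for t
  proof -
    have "G (Suc N + s) t f - G (N + s) t f \<in> adic N" for N f
      using adic_mono[OF step[of "N + s" t f], of N] by simp
    then show ?thesis
      by (rule aug_aut_limit[of "\<lambda>N. G (N + s) t", OF depth_ge_aut[OF G]]) auto
  qed
  then obtain g where g: "\<And>t. aug_aut (g t)" and lim: "\<And>t N f. g t f - G (N + s) t f \<in> adic N"
    by metis
  have "h = comm_prod a g k"
  proof (rule aug_hom_eqI)
    show "aug_hom h" by (rule depth_ge_hom[OF h])
    show "aug_hom (comm_prod a g k)" by (intro aug_aut_hom aug_aut_comm_prod a g)
    fix l
    have "h (mps_X l) - comm_prod a g k (mps_X l) \<in> adic N" for N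
    proof -
      have "comm_prod a g k (mps_X l) - comm_prod a (G (N + s)) k (mps_X l) \<in> adic N"
        by (rule comm_prod_approx[OF a depth_ge_aut[OF G] g lim])
      from adic_diff[OF adic_mono[OF P[of l "N + s"], of N] this] show ?thesis by simp
    qed
    then show "h (mps_X l) = comm_prod a g k (mps_X l)"
      using adic_separated[of "h (mps_X l) - comm_prod a g k (mps_X l)"] by simp
  qed
  with g show ?thesis by blast
qed

section \<open>Counting commutators\<close>

text \<open>
  The first \<open>n\<close> entries of the sequence \<open>a\<close> are the \<open>\<sigma>\<^sub>i\<close>, the next \<open>n\<close> are the \<open>\<tau>\<^sub>i\<close>.
\<close>

theorem GI_subset_commutator_products:
  fixes R :: "'a::comm_ring_1 itself" and N :: "'n::finite itself"
  assumes p: "Factorial_Ring.prime p" "p \<ge> 5" and p0: "of_nat p = (0 :: 'a)"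
  shows "GI R N \<subseteq> commutator_products (GA R N) (2 * CARD('n))"
proof
  fix h assume "h \<in> GI R N"
  then have h: "depth_ge 1 h" by (simp add: GI_iff)
  obtain u v :: 'a where uv: "u * v = 1" and u1: "u ^ (p - 1) = 1"
    and unit: "\<And>m n. \<not> [m = n] (mod (p - 1)) \<Longrightarrow> \<exists>w. (u ^ m - u ^ n) * w = 1"
    using primitive_root_of_unity_mod_p[OF p(1) p0] by blast
  obtain e where e: "bij_betw e {0..<CARD('n)} (UNIV :: 'n set)"
    using ex_bij_betw_nat_finite[of "UNIV :: 'n set"] by auto
  define a :: "nat \<Rightarrow> ('a, 'n) mps \<Rightarrow> ('a, 'n) mps" where
    "a t = (if t < CARD('n) then square_aut (e t) else twisted_power_aut p u (e (t - CARD('n))))" for t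
  have "aug_aut (square_aut i :: ('a, 'n) mps \<Rightarrow> ('a, 'n) mps)" for i
    unfolding square_aut_def by (rule aug_aut_elem) simp
  moreover have "aug_aut (twisted_power_aut p u i :: ('a, 'n) mps \<Rightarrow> ('a, 'n) mps)" for i
    unfolding twisted_power_aut_def
    by (intro aug_aut_comp aug_aut_scale_var(1)[OF uv] aug_aut_elem) (use p(2) in simp)
  ultimately have a: "aug_aut (a t)" for t by (simp add: a_def)
  have "hits_all_terms a (2 * CARD('n)) p"
    unfolding hits_all_terms_def
  proof (intro allI impI)
    fix d j \<alpha> r
    assume "(1::nat) \<le> d" "size (\<alpha> :: 'n multiset) = Suc d"
    from every_term_hit[OF p p0 uv u1 unit this, of j r] obtain i x where
      x: "depth_ge 1 x" "depth_ge (d - p) x" and hit: "hits_term d j \<alpha> r (aut_comm (square_aut i) x)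
        \<or> hits_term d j \<alpha> r (aut_comm (twisted_power_aut p u i) x)" by blast
    have "i \<in> e ` {0..<CARD('n)}" using e by (simp add: bij_betw_def)
    then obtain t where t: "t < CARD('n)" "e t = i" by auto
    have a_t: "a t = square_aut i" "a (CARD('n) + t) = twisted_power_aut p u i"
      using t by (simp_all add: a_def)
    from hit show "\<exists>t<2 * CARD('n). \<exists>x. depth_ge 1 x \<and> depth_ge (d - p) x
        \<and> hits_term d j \<alpha> r (aut_comm (a t) x)"
    proof
      assume "hits_term d j \<alpha> r (aut_comm (square_aut i) x)"
      with x t a_t(1) show ?thesis by (intro exI[of _ t] exI[of _ x] conjI) simp_all
    next
      assume "hits_term d j \<alpha> r (aut_comm (twisted_power_aut p u i) x)"
      with x t a_t(2) show ?thesis by (intro exI[of _ "CARD('n) + t"] exI[of _ x] conjI) simp_all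
    qed
  qed
  from comm_prod_surj[OF a this h] obtain g where
    g: "(\<forall>t. aug_aut (g t)) \<and> h = comm_prod a g (2 * CARD('n))"
    by (elim exE)
  then have "aug_aut (g t)" for t by simp
  from comm_prod_in[where a = a and g = g, OF a this] g
  show "h \<in> commutator_products (GA R N) (2 * CARD('n))" by simp
qed

lemma commutator_products_mono:
  fixes R :: "'a::comm_ring_1 itself" and N :: "'n::finite itself"
  assumes "k \<le> l"
  shows "commutator_products (GA R N) k \<subseteq> commutator_products (GA R N) l"
proof (rule lift_Suc_mono_le[OF _ assms])
  fix k
  have "id = aut_comm id (id :: ('a, 'n) mps \<Rightarrow> ('a, 'n) mps)"
    by (simp add: aut_comm_def inv_id)
  then have "\<theta> = \<theta> \<circ> aut_comm id id" for \<theta> :: "('a, 'n) mps \<Rightarrow> ('a, 'n) mps"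
    by simp
  then show "commutator_products (GA R N) k \<subseteq> commutator_products (GA R N) (Suc k)"
    unfolding commutator_products_Suc_GA using aug_aut_id by blast
qed

lemma one_variable_decomp:
  fixes f :: "('a::comm_ring_1, 'n::finite) mps"
  assumes n: "CARD('n) = 1" and f: "f \<in> adic (Suc 0)"
  shows "\<exists>c. f - mps_const c * mps_X i \<in> adic 2"
proof -
  have UN: "UNIV = {i}" using n by (metis UNIV_I card_1_singletonE singletonD)
  obtain g where "f = (\<Sum>j\<in>UNIV. mps_X j * g j)"
    using adic_Suc_decomp[OF f] by blast
  then have "f = mps_X i * g i" by (simp add: UN)
  moreover have "mps_X i * (g i - mps_const (mps_coeff (g i) {#})) \<in> adic (Suc 0 + Suc 0)"
    by (rule adic_mult[OF mps_X_adic minus_const_adic])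
  ultimately have "f - mps_const (mps_coeff (g i) {#}) * mps_X i \<in> adic 2"
    by (simp add: algebra_simps numeral_2_eq_2)
  then show ?thesis ..
qed

text \<open>
  In one variable an automorphism acts on the ideal modulo its square by a scalar, and scalars commute.
\<close>

lemma one_variable_comm_depth:
  fixes \<phi> \<psi> :: "('a::comm_ring_1, 'n::finite) mps \<Rightarrow> ('a, 'n) mps"
  assumes n: "CARD('n) = 1" and \<phi>: "aug_aut \<phi>" and \<psi>: "aug_aut \<psi>"
  shows "depth_ge 1 (aut_comm \<phi> \<psi>)"
proof (rule depth_geI)
  note h\<phi> = aug_aut_hom[OF \<phi>] and h\<psi> = aug_aut_hom[OF \<psi>]
  have swap: "\<phi> (\<psi> (mps_X i)) - \<psi> (\<phi> (mps_X i)) \<in> adic 2" for i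
  proof -
    obtain b where b: "\<phi> (mps_X i) - mps_const b * mps_X i \<in> adic 2"
      using one_variable_decomp[OF n aug_hom_X[OF h\<phi>]] by blast
    obtain c where c: "\<psi> (mps_X i) - mps_const c * mps_X i \<in> adic 2"
      using one_variable_decomp[OF n aug_hom_X[OF h\<psi>]] by blast
    have 1: "\<phi> (\<psi> (mps_X i)) - mps_const c * \<phi> (mps_X i) \<in> adic 2"
      using aug_hom_adic[OF h\<phi> c]
      by (simp add: aug_hom_diff[OF h\<phi>] aug_hom_mult[OF h\<phi>] aug_hom_const[OF h\<phi>])
    have 2: "\<psi> (\<phi> (mps_X i)) - mps_const b * \<psi> (mps_X i) \<in> adic 2"
      using aug_hom_adic[OF h\<psi> b]
      by (simp add: aug_hom_diff[OF h\<psi>] aug_hom_mult[OF h\<psi>] aug_hom_const[OF h\<psi>])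
    have "mps_const c * (\<phi> (mps_X i) - mps_const b * mps_X i)
        - mps_const b * (\<psi> (mps_X i) - mps_const c * mps_X i) \<in> adic 2"
      by (intro adic_diff adic_mult_left b c)
    from adic_diff[OF adic_add[OF 1 this] 2] show ?thesis
      by (simp add: algebra_simps)
  qed
  have "(\<phi> \<circ> \<psi>) f - (\<psi> \<circ> \<phi>) f \<in> adic (Suc 1)" for f
    by (rule aug_hom_diff_adic(1)[OF aug_hom_comp[OF h\<phi> h\<psi>] aug_hom_comp[OF h\<psi> h\<phi>]])
      (use swap in \<open>simp add: numeral_2_eq_2\<close>)
  then show "aut_comm \<phi> \<psi> (mps_X i) - mps_X i \<in> adic (Suc 1)" for i
    unfolding aut_comm_minus_id[OF \<phi> \<psi> refl] by simp
qed (rule aug_aut_comm[OF \<phi> \<psi>])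

lemma one_variable_commutator_products_subset_GI:
  fixes R :: "'a::comm_ring_1 itself" and N :: "'n::finite itself"
  assumes n: "CARD('n) = 1"
  shows "commutator_products (GA R N) k \<subseteq> GI R N"
proof (induction k)
  case 0
  then show ?case using depth_ge_id by (auto simp: one_GA GI_iff)
next
  case (Suc k)
  show ?case
    unfolding commutator_products_Suc_GA
  proof (intro subsetI, elim CollectE exE conjE)
    fix \<eta> \<theta> \<phi> \<psi> :: "('a, 'n) mps \<Rightarrow> ('a, 'n) mps"
    assume \<theta>: "\<theta> \<in> commutator_products (GA R N) k" and aut: "aug_aut \<phi>" "aug_aut \<psi>"
      and \<eta>: "\<eta> = \<theta> \<circ> aut_comm \<phi> \<psi>"
    have "depth_ge 1 \<theta>" using subsetD[OF Suc.IH \<theta>] by (simp only: GI_iff)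
    then show "\<eta> \<in> GI R N"
      unfolding GI_iff \<eta> by (rule depth_ge_comp[OF _ one_variable_comm_depth[OF n aut]])
  qed
qed

text \<open>
  By induction on \<open>m\<close> the embedding sends the residue of \<open>m\<close> to \<open>m\<close>; for \<open>m = p\<close> this gives \<open>0 = p\<close>.
\<close>

lemma contains_Zp_of_nat:
  assumes p: "Factorial_Ring.prime p" and Zp: "contains_Zp p TYPE('a::comm_ring_1)"
  shows "of_nat p = (0 :: 'a)"
proof -
  obtain h :: "int \<Rightarrow> 'a" where h: "h \<in> ring_hom (residue_ring (int p)) ring_of_type_algebra"
    using Zp by (auto simp: contains_Zp_def)
  have p1: "p > 1" by (rule prime_gt_1_nat[OF p])
  have add: "h ((x + y) mod int p) = h x + h y" if "x \<in> {0..int p - 1}" "y \<in> {0..int p - 1}" for x y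
    using ring_hom_add[OF h, of x y] that by (simp add: residue_ring_def ring_of_type_algebra_def)
  have one: "h 1 = 1"
    using ring_hom_one[OF h] by (simp add: residue_ring_def ring_of_type_algebra_def)
  have zero: "h 0 = 0"
    using add[of 0 0] p1 by simp
  have "h (int m mod int p) = of_nat m" for m
  proof (induction m)
    case (Suc m)
    have "h ((int m mod int p + 1) mod int p) = h (int m mod int p) + h 1"
      using p1 pos_mod_bound[of "int p" "int m"] by (intro add) auto
    then show ?case by (simp add: Suc one mod_add_right_eq add.commute)
  qed (simp add: zero)
  from this[of p] show ?thesis by (simp add: zero)
qed

theorem theorem1p3:
  fixes p :: nat
  assumes "Factorial_Ring.prime p" and "p \<ge> 5"
  shows
    "(contains_Zp p TYPE('r::comm_ring_1) \<and> CARD('n::finite) = 1 \<longrightarrow>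
        GI TYPE('r) TYPE('n) = commutator_products (GA TYPE('r) TYPE('n)) 2) \<and>
     (contains_Zp p TYPE('r) \<and> CARD('n) \<ge> 2 \<longrightarrow>
        GI TYPE('r) TYPE('n) \<subseteq>
          commutator_products (GA TYPE('r) TYPE('n)) (CARD('n) * (CARD('n) + 3))) \<and>
     (CHAR('k::field) = p \<longrightarrow>
        GI TYPE('k) TYPE('n) \<subseteq> commutator_products (GA TYPE('k) TYPE('n)) (4 * CARD('n)))"
proof (intro conjI impI)
  assume r: "contains_Zp p TYPE('r) \<and> CARD('n) = 1"
  then have n: "CARD('n) = 1" ..
  have "GI TYPE('r) TYPE('n) \<subseteq> commutator_products (GA TYPE('r) TYPE('n)) (2 * CARD('n))"
    using r contains_Zp_of_nat[OF assms(1)] by (intro GI_subset_commutator_products[OF assms]) blast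
  then have "GI TYPE('r) TYPE('n) \<subseteq> commutator_products (GA TYPE('r) TYPE('n)) 2"
    unfolding n by simp
  then show "GI TYPE('r) TYPE('n) = commutator_products (GA TYPE('r) TYPE('n)) 2"
    by (rule equalityI[OF _ one_variable_commutator_products_subset_GI[OF n]])
next
  assume r: "contains_Zp p TYPE('r) \<and> CARD('n) \<ge> 2"
  have "GI TYPE('r) TYPE('n) \<subseteq> commutator_products (GA TYPE('r) TYPE('n)) (2 * CARD('n))"
    using r contains_Zp_of_nat[OF assms(1)] by (intro GI_subset_commutator_products[OF assms]) blast
  also have "\<dots> \<subseteq> commutator_products (GA TYPE('r) TYPE('n)) (CARD('n) * (CARD('n) + 3))"
    by (rule commutator_products_mono) (simp add: mult.commute)
  finally show "GI TYPE('r) TYPE('n) \<subseteq>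
      commutator_products (GA TYPE('r) TYPE('n)) (CARD('n) * (CARD('n) + 3))" .
next
  assume k: "CHAR('k) = p"
  have "GI TYPE('k) TYPE('n) \<subseteq> commutator_products (GA TYPE('k) TYPE('n)) (2 * CARD('n))"
    using k of_nat_CHAR[where 'a = 'k] by (intro GI_subset_commutator_products[OF assms]) simp
  also have "\<dots> \<subseteq> commutator_products (GA TYPE('k) TYPE('n)) (4 * CARD('n))"
    by (rule commutator_products_mono) simp
  finally show "GI TYPE('k) TYPE('n) \<subseteq> commutator_products (GA TYPE('k) TYPE('n)) (4 * CARD('n))" .
qed

end
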